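(* Let $G$ be a group, viewed as a $G\times G$-set under left-right translation. Then: (1) if $G$ is finite, it has 0 bi-ends; (2) if $G$ is finite-by-$\mathbf{Z}$, it has 2 bi-ends; (3) if $G$ is infinite, countable and locally finite, then it has $2^{2^{\aleph_0}}$ bi-ends (and actually its space of bi-ends has a continuous surjection onto the Stone-Čech boundary of $\mathbf{N}$); (4) otherwise, $G$ has a single bi-end. Here "otherwise" means that one of the following holds: - $G$ is finitely generated and not virtually cyclic, or - $G$ is finite-by-$D_\infty$, or - $G$ is countable, infinitely generated and not locally finite, or - $G$ is uncountable.
   Context: A subset $X$ of a group $G$ is bi-commensurated if $gX\bigtriangleup X$ and $Xg\bigtriangleup X$ are finite for every $g\in G$. These subsets form a Boolean algebra $\mathcal{P}_{(G\times G)}(G)$; its quotient by the ideal of finite subsets of $G$ is denoted $\mathcal{P}^\star_{G\times G}(G)$. The space of bi-ends of $G$ is the Stone dual $\mathcal{E}^\star_{G\times G}(G)$ of $\mathcal{P}^\star_{G\times G}(G)$ (the compact Hausdorff totally disconnected space whose Boolean algebra of clopen subsets is $\mathcal{P}^\star_{G\times G}(G)$), and its cardinal is the number of bi-ends of $G$. A group is $P$-by-$Q$ if it has a normal subgroup with property $P$ (or isomorphic to $P$) whose quotient has property $Q$ (or is isomorphic to $Q$). $D_\infty$ is the infinite dihedral group. Infinitely generated means not finitely generated. A group is locally finite if all its finitely generated subgroups are finite. The Stone-Čech boundary of $\mathbf{N}$ is $\beta\mathbf{N}\smallsetminus\mathbf{N}$. *)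

theory Defs
  imports "HOL-Algebra.QuotRing" "HOL-Algebra.Elementary_Groups"
    "HOL-Analysis.Abstract_Topology" "HOL-Library.Equipollence"
begin

section \<open>Boolean algebras of subsets and Stone duality\<close>

text \<open>
  A Boolean algebra is treated as a commutative ring in which every element is idempotent: the sum
  is the symmetric difference (join of the two differences) and the product is the meet. In this
  language quotients by ideals are the library's quotient rings.
\<close>

definition set_ring :: "'a set \<Rightarrow> 'a set set \<Rightarrow> 'a set ring"
  where "set_ring U \<A> =
    \<lparr>carrier = \<A>, mult = (\<inter>), one = U, zero = {}, add = (\<lambda>X Y. sym_diff X Y)\<rparr>"

text \<open>
  The Stone dual of a Boolean algebra \<open>R\<close>. The complement of a prime ideal of a Boolean ring is an
  ultrafilter and conversely, so \<open>{P. primeideal P R \<and> a \<notin> P}\<close> is the basic clopen set of the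
  ultrafilters containing \<open>a\<close>. Since prime ideals are proper, these sets cover all prime ideals
  (take \<open>a = \<one>\<^bsub>R\<^esub>\<close>), and the Stone dual of the zero ring is empty.
\<close>

definition stone_dual :: "('a, 'b) ring_scheme \<Rightarrow> 'a set topology"
  where "stone_dual R =
    topology_generated_by ((\<lambda>a. {P. primeideal P R \<and> a \<notin> P}) ` carrier R)"

text \<open>
  As \<open>\<nat>\<close> is discrete, its Stone-Cech compactification is the Stone dual of the algebra of all
  subsets of \<open>\<nat>\<close>, the point \<open>n\<close> being the principal ultrafilter at \<open>n\<close>, that is, the
  prime ideal of the sets that avoid \<open>n\<close>.
\<close>

definition beta_nat :: "nat set set topology"
  where "beta_nat = stone_dual (set_ring UNIV UNIV)"

definition stone_cech_boundary_nat :: "nat set set topology"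
  where "stone_cech_boundary_nat =
    subtopology beta_nat (topspace beta_nat - range (\<lambda>n. {X. n \<notin> X}))"

section \<open>Bi-ends\<close>

definition bicommensurated :: "('a, 'b) monoid_scheme \<Rightarrow> 'a set \<Rightarrow> bool"
  where "bicommensurated G X \<longleftrightarrow> X \<subseteq> carrier G \<and>
    (\<forall>g \<in> carrier G. finite (sym_diff (g <#\<^bsub>G\<^esub> X) X) \<and> finite (sym_diff (X #>\<^bsub>G\<^esub> g) X))"

definition bicomm_algebra :: "('a, 'b) monoid_scheme \<Rightarrow> 'a set ring"
  where "bicomm_algebra G = set_ring (carrier G) {X. bicommensurated G X}"

definition bicomm_algebra_mod_finite :: "('a, 'b) monoid_scheme \<Rightarrow> 'a set set ring"
  where "bicomm_algebra_mod_finite G =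
    bicomm_algebra G Quot {X. X \<subseteq> carrier G \<and> finite X}"

definition biend_space :: "('a, 'b) monoid_scheme \<Rightarrow> 'a set set set topology"
  where "biend_space G = stone_dual (bicomm_algebra_mod_finite G)"

abbreviation biends :: "('a, 'b) monoid_scheme \<Rightarrow> 'a set set set set"
  where "biends G \<equiv> topspace (biend_space G)"

section \<open>Classes of groups\<close>

definition finite_by :: "('a, 'b) monoid_scheme \<Rightarrow> ('c, 'd) monoid_scheme \<Rightarrow> bool"
  where "finite_by G Q \<longleftrightarrow> (\<exists>N. N \<lhd> G \<and> finite N \<and> G Mod N \<cong> Q)"

text \<open>
  The infinite dihedral group as the semidirect product of \<open>\<int>\<close> with the group of order two acting by
  negation; the second component \<open>True\<close> marks the reflections. The pair \<open>(m, s)\<close> corresponds to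
  the isometry \<open>x \<mapsto> m \<plusminus> x\<close> of \<open>\<int>\<close>, with the minus sign iff \<open>s\<close> holds.
\<close>

definition infinite_dihedral_group :: "(int \<times> bool) monoid"
  where "infinite_dihedral_group =
    \<lparr>carrier = UNIV,
     mult = (\<lambda>(m, s) (n, t). (m + (if s then - n else n), s \<noteq> t)),
     one = (0, False)\<rparr>"

definition finitely_generated_group :: "('a, 'b) monoid_scheme \<Rightarrow> bool"
  where "finitely_generated_group G \<longleftrightarrow>
    (\<exists>S. finite S \<and> S \<subseteq> carrier G \<and> generate G S = carrier G)"

definition locally_finite_group :: "('a, 'b) monoid_scheme \<Rightarrow> bool"
  where "locally_finite_group G \<longleftrightarrow>
    (\<forall>S. finite S \<and> S \<subseteq> carrier G \<longrightarrow> finite (generate G S))"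

definition virtually_cyclic_group :: "('a, 'b) monoid_scheme \<Rightarrow> bool"
  where "virtually_cyclic_group G \<longleftrightarrow>
    (\<exists>H. subgroup H G \<and> finite (rcosets\<^bsub>G\<^esub> H) \<and> cyclic_group (subgroup_generated G H))"

section \<open>Well-formedness\<close>

lemma set_ring_simps [simp]:
  "carrier (set_ring U \<A>) = \<A>"
  "mult (set_ring U \<A>) X Y = X \<inter> Y"
  "one (set_ring U \<A>) = U"
  "zero (set_ring U \<A>) = {}"
  "add (set_ring U \<A>) X Y = sym_diff X Y"
  by (simp_all add: set_ring_def)

lemma cring_set_ring:
  assumes "\<A> \<subseteq> Pow U" "U \<in> \<A>" "{} \<in> \<A>"
    and "\<And>X Y. X \<in> \<A> \<Longrightarrow> Y \<in> \<A> \<Longrightarrow> X \<inter> Y \<in> \<A>"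
    and "\<And>X Y. X \<in> \<A> \<Longrightarrow> Y \<in> \<A> \<Longrightarrow> sym_diff X Y \<in> \<A>"
  shows "cring (set_ring U \<A>)"
proof (rule cringI)
  show "abelian_group (set_ring U \<A>)"
  proof (rule abelian_groupI)
    fix X assume "X \<in> carrier (set_ring U \<A>)"
    then show "\<exists>Y \<in> carrier (set_ring U \<A>). Y \<oplus>\<^bsub>set_ring U \<A>\<^esub> X = \<zero>\<^bsub>set_ring U \<A>\<^esub>"
      by (intro bexI[of _ X]) auto
  qed (use assms in auto)
  show "comm_monoid (set_ring U \<A>)"
    by (rule comm_monoidI) (use assms in auto)
qed auto

lemma bicommensurated_sym_diff:
  fixes G (structure)
  assumes "group G" "bicommensurated G X" "bicommensurated G Y"
  shows "bicommensurated G (sym_diff X Y)"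
proof -
  interpret group G by fact
  have sub: "X \<subseteq> carrier G" "Y \<subseteq> carrier G"
    using assms by (auto simp: bicommensurated_def)
  have l: "g <# A = (\<lambda>x. g \<otimes> x) ` A" and r: "A #> g = (\<lambda>x. x \<otimes> g) ` A" for g A
    by (auto simp: l_coset_def r_coset_def)
  show ?thesis
    unfolding bicommensurated_def
  proof (intro conjI ballI)
    show "sym_diff X Y \<subseteq> carrier G" using sub by auto
  next
    fix g assume g: "g \<in> carrier G"
    have inj: "inj_on (\<lambda>x. g \<otimes> x) (carrier G)" "inj_on (\<lambda>x. x \<otimes> g) (carrier G)"
      using g by (auto simp: inj_on_def)
    have "g <# (sym_diff X Y) = sym_diff (g <# X) (g <# Y)"
      unfolding l using inj sub by (simp add: image_Un inj_on_image_set_diff[of _ "carrier G"] Diff_subset[THEN subset_trans])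
    then have "sym_diff (g <# (sym_diff X Y)) (sym_diff X Y)
        \<subseteq> sym_diff (g <# X) X \<union> sym_diff (g <# Y) Y" by blast
    then show "finite (sym_diff (g <# (sym_diff X Y)) (sym_diff X Y))"
      by (rule finite_subset) (use assms g in \<open>auto simp: bicommensurated_def\<close>)
    have "(sym_diff X Y) #> g = sym_diff (X #> g) (Y #> g)"
      unfolding r using inj sub by (simp add: image_Un inj_on_image_set_diff[of _ "carrier G"] Diff_subset[THEN subset_trans])
    then have "sym_diff ((sym_diff X Y) #> g) (sym_diff X Y)
        \<subseteq> sym_diff (X #> g) X \<union> sym_diff (Y #> g) Y" by blast
    then show "finite (sym_diff ((sym_diff X Y) #> g) (sym_diff X Y))"
      by (rule finite_subset) (use assms g in \<open>auto simp: bicommensurated_def\<close>)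
  qed
qed

lemma bicommensurated_Int:
  fixes G (structure)
  assumes "group G" "bicommensurated G X" "bicommensurated G Y"
  shows "bicommensurated G (X \<inter> Y)"
proof -
  interpret group G by fact
  have sub: "X \<subseteq> carrier G" "Y \<subseteq> carrier G"
    using assms by (auto simp: bicommensurated_def)
  have l: "g <# A = (\<lambda>x. g \<otimes> x) ` A" and r: "A #> g = (\<lambda>x. x \<otimes> g) ` A" for g A
    by (auto simp: l_coset_def r_coset_def)
  show ?thesis
    unfolding bicommensurated_def
  proof (intro conjI ballI)
    show "X \<inter> Y \<subseteq> carrier G" using sub by auto
  next
    fix g assume g: "g \<in> carrier G"
    have inj: "inj_on (\<lambda>x. g \<otimes> x) (carrier G)" "inj_on (\<lambda>x. x \<otimes> g) (carrier G)"
      using g by (auto simp: inj_on_def)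
    have "g <# (X \<inter> Y) = (g <# X) \<inter> (g <# Y)"
      unfolding l using inj sub by (simp add: inj_on_image_Int[of _ "carrier G"])
    then have "sym_diff (g <# (X \<inter> Y)) (X \<inter> Y)
        \<subseteq> sym_diff (g <# X) X \<union> sym_diff (g <# Y) Y" by blast
    then show "finite (sym_diff (g <# (X \<inter> Y)) (X \<inter> Y))"
      by (rule finite_subset) (use assms g in \<open>auto simp: bicommensurated_def\<close>)
    have "(X \<inter> Y) #> g = (X #> g) \<inter> (Y #> g)"
      unfolding r using inj sub by (simp add: inj_on_image_Int[of _ "carrier G"])
    then have "sym_diff ((X \<inter> Y) #> g) (X \<inter> Y)
        \<subseteq> sym_diff (X #> g) X \<union> sym_diff (Y #> g) Y" by blast
    then show "finite (sym_diff ((X \<inter> Y) #> g) (X \<inter> Y))"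
      by (rule finite_subset) (use assms g in \<open>auto simp: bicommensurated_def\<close>)
  qed
qed

lemma bicommensurated_finite:
  assumes "X \<subseteq> carrier G" "finite X"
  shows "bicommensurated G X"
  using assms by (simp add: bicommensurated_def l_coset_def r_coset_def)

lemma bicommensurated_carrier:
  fixes G (structure)
  assumes "group G"
  shows "bicommensurated G (carrier G)"
proof -
  interpret group G by fact
  have "g <# carrier G = carrier G" "carrier G #> g = carrier G" if "g \<in> carrier G" for g
    using that coset_join2 coset_join3 subgroup_self by blast+
  then show ?thesis by (simp add: bicommensurated_def)
qed

lemma cring_bicomm_algebra:
  assumes "group G"
  shows "cring (bicomm_algebra G)"
  unfolding bicomm_algebra_def
proof (rule cring_set_ring)
  show "{X. bicommensurated G X} \<subseteq> Pow (carrier G)"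
    by (auto simp: bicommensurated_def)
qed (use assms in \<open>auto intro: bicommensurated_sym_diff bicommensurated_Int
      bicommensurated_finite bicommensurated_carrier\<close>)

lemma ideal_finite_subsets:
  assumes "group G"
  shows "ideal {X. X \<subseteq> carrier G \<and> finite X} (bicomm_algebra G)"
proof -
  interpret R: cring "bicomm_algebra G" using assms by (rule cring_bicomm_algebra)
  have a_inv: "\<ominus>\<^bsub>bicomm_algebra G\<^esub> X = X" if "bicommensurated G X" for X
    using that by (intro R.minus_equality) (auto simp: bicomm_algebra_def)
  show ?thesis
  proof (rule idealI[OF R.ring_axioms])
    show "subgroup {X. X \<subseteq> carrier G \<and> finite X} (add_monoid (bicomm_algebra G))"
    proof (rule group.subgroupI[OF R.a_group])
      fix X assume X: "X \<in> {X. X \<subseteq> carrier G \<and> finite X}"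
      then have "inv\<^bsub>add_monoid (bicomm_algebra G)\<^esub> X = X"
        using a_inv[of X] by (simp add: bicommensurated_finite a_inv_def)
      with X show "inv\<^bsub>add_monoid (bicomm_algebra G)\<^esub> X \<in> {X. X \<subseteq> carrier G \<and> finite X}"
        by simp
    qed (auto simp: bicomm_algebra_def bicommensurated_finite)
  qed (auto simp: bicomm_algebra_def bicommensurated_def)
qed

lemma topspace_stone_dual:
  assumes "ring R"
  shows "topspace (stone_dual R) = {P. primeideal P R}"
proof -
  interpret ring R by fact
  have "\<one>\<^bsub>R\<^esub> \<notin> P" if "primeideal P R" for P
    using that ideal.one_imp_carrier primeideal.I_notcarr primeideal.axioms(1) by metis
  then show ?thesis
    by (auto simp: stone_dual_def)
qed

lemma group_infinite_dihedral_group: "group infinite_dihedral_group"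
proof (rule groupI)
  fix x assume "x \<in> carrier infinite_dihedral_group"
  obtain m s where x: "x = (m, s)" by (cases x)
  show "\<exists>y \<in> carrier infinite_dihedral_group.
      y \<otimes>\<^bsub>infinite_dihedral_group\<^esub> x = \<one>\<^bsub>infinite_dihedral_group\<^esub>"
    unfolding x infinite_dihedral_group_def
    by (intro bexI[of _ "(if s then m else - m, s)"]) auto
qed (auto simp: infinite_dihedral_group_def)

end

theory Submission
  imports Defs "HOL-Algebra.Multiplicative_Group"
begin

text \<open>
  A bi-end is a prime ideal of the algebra of bi-commensurated sets that contains the finite sets.
  So a group in which every bi-commensurated set is finite or cofinite has at most one bi-end, and
  everything depends on which groups have a bi-commensurated set \<open>X\<close> such that \<open>X\<close> and its
  complement are both infinite.

  Let \<open>H\<close> be an infinite subgroup generated by a finite set. Because \<open>X\<close> is commensurated on the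
  right, all but finitely many left cosets \<open>gH\<close> lie in \<open>X\<close> or miss it; because it is commensurated
  on the left, \<open>X \<inter> gH\<close> agrees with \<open>g(X \<inter> H)\<close> up to a finite set. If \<open>X \<inter> H\<close> is finite, this
  forces \<open>X\<close> to be finite; if \<open>X\<close> and its complement both meet \<open>H\<close> in infinite sets, it leaves only
  finitely many cosets. Hence a group with such an \<open>X\<close> is locally finite or finitely generated
  (\<open>finite_or_cofinite_if_not_finitely_generated\<close>). With a countable \<open>H\<close> that meets both \<open>X\<close> and
  its complement in infinite sets, the same count shows that the group is countable
  (\<open>finite_or_cofinite_if_uncountable\<close>).

  For finitely generated \<open>G\<close>, the displacement \<open>g \<mapsto> |gX - X| - |X - gX|\<close> is a homomorphism to
  \<open>\<int>\<close>. For all but finitely many \<open>g\<close> the sets \<open>X\<close> and \<open>gX\<close> are nested, since the finitely many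
  edges of the Cayley graph that leave \<open>X\<close> lie on one side of \<open>gX\<close>, and conversely. When \<open>X\<close> and
  \<open>gX\<close> are nested, vanishing displacement means \<open>gX = X\<close>, which happens for finitely many \<open>g\<close> only.
  So the kernel is finite and \<open>G\<close> is finite-by-\<open>\<int>\<close> (\<open>finite_displacement_kernel\<close>).
  If \<open>X\<close> is commensurated on the right and each left translate agrees, up to a finite set, with
  \<open>X\<close> or with its complement, the displacement is defined on a subgroup of index at most two, and
  \<open>G\<close> is finite-by-\<open>\<int>\<close> or finite-by-\<open>D\<^sub>\<infinity>\<close>. Applied to one half of an infinite virtually cyclic
  group, this shows that the four classes in the last case are precisely the remaining groups.

  In a finite-by-\<open>\<int>\<close> group, the elements of positive and those of nonpositive image in \<open>\<int>\<close> form
  two halves neither of which can be split further by a bi-commensurated set, whence two bi-ends.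
  A countable infinite locally finite group is an increasing union of finite subgroups, and left and
  right translations preserve the stage at which an element appears, with finitely many exceptions.
  So the sets described by a condition on the stage are bi-commensurated; they form a copy of the
  algebra of all subsets of \<open>\<nat>\<close>, and restricting prime ideals to it gives the surjection onto
  \<open>\<beta>\<nat> - \<nat>\<close>. That space has \<open>2\<close> to the power \<open>2\<close> to the power \<open>\<aleph>\<^sub>0\<close> points, by an independent
  family of subsets of \<open>\<nat>\<close> indexed by the continuum (\<open>lepoll_boundary\<close>).
\<close>

section \<open>Commensuration and subgroups\<close>

context group
begin

definition right_jumps :: "'a set \<Rightarrow> 'a \<Rightarrow> 'a set"
  where "right_jumps X g = {x \<in> carrier G. (x \<in> X) \<noteq> (x \<otimes> g \<in> X)}"

definition left_jumps :: "'a set \<Rightarrow> 'a \<Rightarrow> 'a set"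
  where "left_jumps X g = {x \<in> carrier G. (x \<in> X) \<noteq> (g \<otimes> x \<in> X)}"

definition right_commensurated :: "'a set \<Rightarrow> bool"
  where "right_commensurated X \<longleftrightarrow> X \<subseteq> carrier G \<and> (\<forall>g \<in> carrier G. finite (right_jumps X g))"

lemma l_coset_mem_iff:
  assumes "X \<subseteq> carrier G" "g \<in> carrier G" "x \<in> carrier G"
  shows "x \<in> g <# X \<longleftrightarrow> inv g \<otimes> x \<in> X"
proof
  assume "x \<in> g <# X"
  then obtain y where "y \<in> X" "x = g \<otimes> y" by (auto simp: l_coset_def)
  with assms show "inv g \<otimes> x \<in> X" by (auto simp flip: m_assoc)
next
  assume "inv g \<otimes> x \<in> X"
  moreover have "x = g \<otimes> (inv g \<otimes> x)" using assms by (simp flip: m_assoc)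
  ultimately show "x \<in> g <# X" unfolding l_coset_def by blast
qed

lemma r_coset_mem_iff:
  assumes "X \<subseteq> carrier G" "g \<in> carrier G" "x \<in> carrier G"
  shows "x \<in> X #> g \<longleftrightarrow> x \<otimes> inv g \<in> X"
proof
  assume "x \<in> X #> g"
  then obtain y where "y \<in> X" "x = y \<otimes> g" by (auto simp: r_coset_def)
  with assms show "x \<otimes> inv g \<in> X" by (auto simp: m_assoc)
next
  assume "x \<otimes> inv g \<in> X"
  moreover have "x = x \<otimes> inv g \<otimes> g" using assms by (simp add: m_assoc)
  ultimately show "x \<in> X #> g" unfolding r_coset_def by blast
qed

lemma l_coset_carrier: "X \<subseteq> carrier G \<Longrightarrow> g \<in> carrier G \<Longrightarrow> g <# X \<subseteq> carrier G"
  by (auto simp: l_coset_def)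

text \<open>
  Commensuration is used pointwise, as finiteness of the set of points at which multiplication by
  \<open>g\<close> enters or leaves \<open>X\<close>. Those points are carried bijectively onto \<open>gX \<triangle> X\<close> by \<open>g\<close>.
\<close>
lemma finite_l_coset_diff_iff:
  assumes X: "X \<subseteq> carrier G" and g: "g \<in> carrier G"
  shows "finite (sym_diff (g <# X) X) \<longleftrightarrow> finite (left_jumps X g)"
proof -
  have "sym_diff (g <# X) X = (\<lambda>x. g \<otimes> x) ` left_jumps X g"
  proof (intro equalityI subsetI)
    fix x assume x: "x \<in> sym_diff (g <# X) X"
    then have c: "x \<in> carrier G" using X l_coset_carrier[OF X g] by auto
    with x have "inv g \<otimes> x \<in> left_jumps X g"
      using X g by (auto simp: left_jumps_def l_coset_mem_iff simp flip: m_assoc)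
    moreover have "x = g \<otimes> (inv g \<otimes> x)" using c g by (simp flip: m_assoc)
    ultimately show "x \<in> (\<lambda>x. g \<otimes> x) ` left_jumps X g" by blast
  qed (use X g in \<open>auto simp: left_jumps_def l_coset_mem_iff simp flip: m_assoc\<close>)
  moreover have "inj_on (\<lambda>x. g \<otimes> x) (left_jumps X g)"
    using g by (auto simp: inj_on_def left_jumps_def)
  ultimately show ?thesis by (simp add: finite_image_iff)
qed

lemma finite_r_coset_diff_iff:
  assumes X: "X \<subseteq> carrier G" and g: "g \<in> carrier G"
  shows "finite (sym_diff (X #> g) X) \<longleftrightarrow> finite (right_jumps X g)"
proof -
  have "sym_diff (X #> g) X = (\<lambda>x. x \<otimes> g) ` right_jumps X g"
  proof (intro equalityI subsetI)
    fix x assume x: "x \<in> sym_diff (X #> g) X"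
    then have c: "x \<in> carrier G" using X r_coset_subset_G[OF X g] by auto
    with x have "x \<otimes> inv g \<in> right_jumps X g"
      using X g by (auto simp: right_jumps_def r_coset_mem_iff m_assoc)
    moreover have "x = x \<otimes> inv g \<otimes> g" using c g by (simp add: m_assoc)
    ultimately show "x \<in> (\<lambda>x. x \<otimes> g) ` right_jumps X g" by blast
  qed (use X g in \<open>auto simp: right_jumps_def r_coset_mem_iff m_assoc\<close>)
  moreover have "inj_on (\<lambda>x. x \<otimes> g) (right_jumps X g)"
    using g by (auto simp: inj_on_def right_jumps_def)
  ultimately show ?thesis by (simp add: finite_image_iff)
qed

lemma bicommensurated_iff_jumps:
  "bicommensurated G X \<longleftrightarrow> X \<subseteq> carrier G \<and>
    (\<forall>g \<in> carrier G. finite (left_jumps X g) \<and> finite (right_jumps X g))"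
  unfolding bicommensurated_def
  by (intro conj_cong refl ball_cong) (simp_all only: finite_l_coset_diff_iff finite_r_coset_diff_iff)

lemma bicommensurated_compl:
  assumes "bicommensurated G X"
  shows "bicommensurated G (carrier G - X)"
proof -
  have "left_jumps (carrier G - X) g = left_jumps X g"
    "right_jumps (carrier G - X) g = right_jumps X g" if "g \<in> carrier G" for g
    using that by (auto simp: left_jumps_def right_jumps_def)
  with assms show ?thesis by (simp add: bicommensurated_iff_jumps)
qed

text \<open>
  The left coset of \<open>x\<close> is a connected component of the graph whose edges join \<open>y\<close> to \<open>ys\<close>
  for \<open>s \<in> S\<close>; membership in \<open>X\<close> can change along it only across an edge that is a jump.
\<close>
lemma no_jump_on_coset:
  assumes S: "S \<subseteq> carrier G" and h: "h \<in> generate G S" and x: "x \<in> carrier G"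
    and "\<And>k s. k \<in> generate G S \<Longrightarrow> s \<in> S \<Longrightarrow> x \<otimes> k \<notin> right_jumps X s"
  shows "x \<otimes> h \<in> X \<longleftrightarrow> x \<in> X"
  using h x assms(4)
proof (induction h arbitrary: x rule: generate.induct)
  case one
  then show ?case by simp
next
  case (incl h)
  then have "x \<otimes> \<one> \<notin> right_jumps X h" using generate.one by blast
  with incl show ?case by (auto simp: right_jumps_def)
next
  case (inv h)
  then have h: "h \<in> carrier G" using S by auto
  have "x \<otimes> inv h \<notin> right_jumps X h" using inv generate.inv by metis
  with inv h show ?case by (auto simp: right_jumps_def m_assoc)
next
  case (eng h1 h2)
  have c: "h1 \<in> carrier G" "h2 \<in> carrier G" using eng S generate_in_carrier by auto
  have "(x \<otimes> h1) \<otimes> h2 \<in> X \<longleftrightarrow> x \<otimes> h1 \<in> X"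
  proof (rule eng.IH(2))
    fix k s assume k: "k \<in> generate G S" "s \<in> S"
    then have "x \<otimes> (h1 \<otimes> k) \<notin> right_jumps X s"
      using eng by (meson generate.eng)
    then show "x \<otimes> h1 \<otimes> k \<notin> right_jumps X s"
      using k S c eng.prems(1) by (simp add: m_assoc generate_in_carrier)
  qed (use eng c in auto)
  also have "\<dots> \<longleftrightarrow> x \<in> X"
    by (rule eng.IH(1)) (use eng in auto)
  finally show ?case using c eng.prems by (simp add: m_assoc)
qed

text \<open>
  Let \<open>H\<close> be the subgroup generated by \<open>S\<close>. The traces of \<open>X\<close> and of its complement on \<open>xH\<close> are the
  translates by \<open>x\<close> of their infinite traces on \<open>H\<close>, up to finite sets; in particular they are not
  empty. So each left coset \<open>xH\<close> contains a jump, and there are at most as many cosets as jumps.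
\<close>
lemma coset_meets_jumps:
  assumes X: "bicommensurated G X" and S: "S \<subseteq> carrier G"
    and inf: "infinite (generate G S \<inter> X)" "infinite (generate G S - X)"
    and x: "x \<in> carrier G"
  obtains j h s where "s \<in> S" "j \<in> right_jumps X s" "h \<in> generate G S" "x = j \<otimes> h"
proof -
  have fin: "finite (left_jumps X x)" using X x by (simp add: bicommensurated_iff_jumps)
  obtain h where h: "h \<in> generate G S \<inter> X - left_jumps X x"
    using infinite_imp_nonempty[OF Diff_infinite_finite[OF fin inf(1)]] by blast
  obtain h' where h': "h' \<in> generate G S - X - left_jumps X x"
    using infinite_imp_nonempty[OF Diff_infinite_finite[OF fin inf(2)]] by blast
  have "h \<in> carrier G" "h' \<in> carrier G" using h h' S generate_in_carrier by auto
  with h h' have "x \<otimes> h \<in> X" "x \<otimes> h' \<notin> X" by (auto simp: left_jumps_def)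
  then obtain k s where k: "k \<in> generate G S" "s \<in> S" "x \<otimes> k \<in> right_jumps X s"
    using no_jump_on_coset[OF S _ x, of _ X] h h' by blast
  have kc: "k \<in> carrier G" using k S generate_in_carrier by auto
  have "x = (x \<otimes> k) \<otimes> inv k" using x kc by (simp add: m_assoc)
  moreover have "inv k \<in> generate G S" using generate_m_inv_closed[OF S k(1)] .
  ultimately show thesis using that k by blast
qed

text \<open>
  A coset \<open>xH\<close> without jumps that meets \<open>X\<close> would be contained in \<open>X\<close>, whereas \<open>X \<inter> xH\<close> is finite
  like \<open>X \<inter> H\<close>. So \<open>X\<close> lies in the finitely many cosets with jumps and has a finite trace on each.
\<close>
lemma finite_if_finite_trace:
  assumes X: "bicommensurated G X" and S: "S \<subseteq> carrier G" "finite S"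
    and inf: "infinite (generate G S)" and fin: "finite (generate G S \<inter> X)"
  shows "finite X"
proof -
  let ?H = "generate G S"
  define J where "J = (\<Union>s\<in>S. right_jumps X s)"
  have "finite J" using X S by (auto simp: J_def bicommensurated_iff_jumps)
  have Jc: "J \<subseteq> carrier G" by (auto simp: J_def right_jumps_def)
  have "X \<subseteq> (\<Union>j\<in>J. (\<lambda>h. j \<otimes> h) ` (left_jumps X j \<union> (?H \<inter> X)))"
  proof
    fix x assume xX: "x \<in> X"
    then have x: "x \<in> carrier G" using X by (auto simp: bicommensurated_def)
    have "\<exists>k \<in> ?H. x \<otimes> k \<in> J"
    proof (rule ccontr)
      assume "\<not> ?thesis"
      then have "x \<otimes> h \<in> X" if "h \<in> ?H" for h
        using no_jump_on_coset[OF S(1) that x, of X] xX by (auto simp: J_def)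
      then have "?H \<subseteq> left_jumps X x \<union> (?H \<inter> X)"
        using generate_in_carrier[OF S(1)] by (auto simp: left_jumps_def)
      moreover have "finite (left_jumps X x)" using X x by (simp add: bicommensurated_iff_jumps)
      ultimately show False using inf fin finite_subset by blast
    qed
    then obtain k where k: "k \<in> ?H" "x \<otimes> k \<in> J" by blast
    have kc: "k \<in> carrier G" using k S generate_in_carrier by auto
    have eq: "x = (x \<otimes> k) \<otimes> inv k" using x kc by (simp add: m_assoc)
    have "inv k \<in> ?H" using generate_m_inv_closed[OF S(1) k(1)] .
    then have "inv k \<in> left_jumps X (x \<otimes> k) \<union> (?H \<inter> X)"
      using eq xX kc by (auto simp: left_jumps_def)
    with eq k(2) show "x \<in> (\<Union>j\<in>J. (\<lambda>h. j \<otimes> h) ` (left_jumps X j \<union> (?H \<inter> X)))" by blast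
  qed
  moreover have "finite (\<Union>j\<in>J. (\<lambda>h. j \<otimes> h) ` (left_jumps X j \<union> (?H \<inter> X)))"
    using \<open>finite J\<close> Jc X fin by (auto simp: bicommensurated_iff_jumps)
  ultimately show ?thesis by (rule finite_subset)
qed

text \<open>
  Take \<open>H\<close> infinite and finitely generated. If neither \<open>X\<close> nor its complement has a finite trace on
  \<open>H\<close>, then the finitely many jumps represent all cosets of \<open>H\<close> and generate \<open>G\<close> together with \<open>H\<close>.
\<close>
lemma finite_or_cofinite_if_not_finitely_generated:
  assumes X: "bicommensurated G X"
    and "\<not> finitely_generated_group G" "\<not> locally_finite_group G"
  shows "finite X \<or> finite (carrier G - X)"
proof (rule ccontr)
  assume neg: "\<not> ?thesis"
  obtain S where S: "S \<subseteq> carrier G" "finite S" and inf: "infinite (generate G S)"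
    using assms by (auto simp: locally_finite_group_def)
  have "infinite (generate G S \<inter> X)"
    using finite_if_finite_trace[OF X S inf] neg by blast
  moreover have "generate G S - X = generate G S \<inter> (carrier G - X)"
    using generate_in_carrier[OF S(1)] by blast
  then have "infinite (generate G S - X)"
    using finite_if_finite_trace[OF bicommensurated_compl[OF X] S inf] neg by auto
  ultimately have inf2: "infinite (generate G S \<inter> X)" "infinite (generate G S - X)" .
  define J where "J = (\<Union>s\<in>S. right_jumps X s)"
  have Jc: "J \<subseteq> carrier G" by (auto simp: J_def right_jumps_def)
  have JS: "finite (J \<union> S)" "J \<union> S \<subseteq> carrier G"
    using X S Jc by (auto simp: J_def bicommensurated_iff_jumps)
  have "carrier G \<subseteq> generate G (J \<union> S)"
  proof
    fix x assume "x \<in> carrier G"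
    then obtain j h s where *: "s \<in> S" "j \<in> right_jumps X s" "h \<in> generate G S" "x = j \<otimes> h"
      using coset_meets_jumps[OF X S(1) inf2] by blast
    have "generate G S \<subseteq> generate G (J \<union> S)" by (rule mono_generate) auto
    moreover have "j \<in> generate G (J \<union> S)" using * by (auto simp: J_def intro: generate.incl)
    ultimately show "x \<in> generate G (J \<union> S)" using * by (blast intro: generate.eng)
  qed
  then have "finitely_generated_group G"
    unfolding finitely_generated_group_def using JS generate_incl[OF JS(2)] by blast
  with assms show False by simp
qed

lemma countable_generate:
  assumes S: "S \<subseteq> carrier G" "countable S"
  shows "countable (generate G S)"
proof -
  define ev where "ev w = foldr (\<otimes>) w \<one>" for w
  let ?L = "S \<union> m_inv G ` S"
  have closed: "ev w \<in> carrier G" if "w \<in> lists ?L" for w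
    using that S(1) by induction (auto simp: ev_def)
  have app: "ev (v @ w) = ev v \<otimes> ev w" if "v \<in> lists ?L" "w \<in> lists ?L" for v w
    using that
  proof induction
    case Nil
    then show ?case using closed by (simp add: ev_def)
  next
    case (Cons a v)
    moreover have "a \<in> carrier G" using Cons S(1) by auto
    ultimately show ?case using closed[of v] closed[of w] S(1) by (auto simp: ev_def m_assoc)
  qed
  have "h \<in> ev ` lists ?L" if "h \<in> generate G S" for h
    using that
  proof induction
    case one
    show ?case by (rule image_eqI[of _ _ "[]"]) (auto simp: ev_def)
  next
    case (incl h)
    then show ?case using S(1) by (intro image_eqI[of _ _ "[h]"]) (auto simp: ev_def)
  next
    case (inv h)
    then show ?case using S(1) by (intro image_eqI[of _ _ "[inv h]"]) (auto simp: ev_def)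
  next
    case (eng h1 h2)
    then obtain v w where "v \<in> lists ?L" "w \<in> lists ?L" "h1 = ev v" "h2 = ev w" by blast
    then show ?case by (intro image_eqI[of _ _ "v @ w"]) (auto simp: app)
  qed
  then have "generate G S \<subseteq> ev ` lists ?L" by blast
  moreover have "countable (ev ` lists ?L)" using S by simp
  ultimately show ?thesis by (rule countable_subset)
qed

text \<open>
  A countable \<open>S\<close> that meets \<open>X\<close> and its complement in infinite sets has countably many jumps, and
  these represent all cosets of the countable subgroup that it generates.
\<close>
lemma finite_or_cofinite_if_uncountable:
  assumes X: "bicommensurated G X" and unc: "uncountable (carrier G)"
  shows "finite X \<or> finite (carrier G - X)"
proof (rule ccontr)
  assume neg: "\<not> ?thesis"
  obtain A where A: "countable A" "infinite A" "A \<subseteq> X"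
    using neg infinite_countable_subset' by blast
  obtain B where B: "countable B" "infinite B" "B \<subseteq> carrier G - X"
    using neg infinite_countable_subset' by blast
  let ?S = "A \<union> B"
  have S: "?S \<subseteq> carrier G" "countable ?S" using A B X by (auto simp: bicommensurated_def)
  have "A \<subseteq> generate G ?S \<inter> X" "B \<subseteq> generate G ?S - X"
    using A B by (auto intro: generate.incl)
  then have inf: "infinite (generate G ?S \<inter> X)" "infinite (generate G ?S - X)"
    using A B finite_subset by blast+
  let ?C = "(\<Union>s\<in>?S. right_jumps X s) \<times> generate G ?S"
  have cover: "carrier G \<subseteq> (\<lambda>(j, h). j \<otimes> h) ` ?C"
  proof
    fix x assume "x \<in> carrier G"
    then obtain j h s where *: "s \<in> ?S" "j \<in> right_jumps X s" "h \<in> generate G ?S" "x = j \<otimes> h"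
      using coset_meets_jumps[OF X S(1) inf] by blast
    then show "x \<in> (\<lambda>(j, h). j \<otimes> h) ` ?C" by (intro image_eqI[of _ _ "(j, h)"]) auto
  qed
  have "countable (right_jumps X s)" if "s \<in> ?S" for s
    using that X S by (intro countable_finite) (metis bicommensurated_iff_jumps subsetD)
  then have "countable ?C"
    using countable_generate[OF S] S(2) by (intro countable_SIGMA countable_UN) auto
  then show False
    using unc cover countable_image countable_subset by blast
qed

end

section \<open>Displacement of an almost invariant set\<close>

definition almost_eq :: "'a set \<Rightarrow> 'a set \<Rightarrow> bool"
  where "almost_eq A B \<longleftrightarrow> finite (sym_diff A B)"

lemma almost_eq_refl: "almost_eq A A"
  by (simp add: almost_eq_def)

lemma almost_eq_sym: "almost_eq A B \<Longrightarrow> almost_eq B A"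
  by (simp add: almost_eq_def Un_commute)

lemma almost_eq_trans [trans]: "almost_eq A B \<Longrightarrow> almost_eq B C \<Longrightarrow> almost_eq A C"
  unfolding almost_eq_def by (erule (1) finite_subset[rotated, OF finite_UnI]) blast

lemma almost_eq_compl: "almost_eq A B \<Longrightarrow> almost_eq (U - A) (U - B)"
  unfolding almost_eq_def by (erule finite_subset[rotated]) blast

text \<open>
  The relative size of two sets that differ by a finite set; it is additive along chains of such
  sets although the sets themselves may be infinite.
\<close>
definition excess :: "'a set \<Rightarrow> 'a set \<Rightarrow> int"
  where "excess A B = int (card (A - B)) - int (card (B - A))"

text \<open>
  Measuring both sets against a common part \<open>D\<close> turns the excess into a difference of two numbers
  of which each depends on one of the sets only. This is what makes it additive.
\<close>
lemma excess_eq_core: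
  assumes "D \<subseteq> A" "D \<subseteq> B" "finite (A - D)" "finite (B - D)"
  shows "excess A B = int (card (A - D)) - int (card (B - D))"
proof -
  have split: "card (P - D) = card (P - Q) + card (P \<inter> Q - D)"
    if "D \<subseteq> Q" "finite (P - D)" for P Q
  proof -
    have eq: "P - D = (P - Q) \<union> (P \<inter> Q - D)" using that by blast
    have "finite ((P - Q) \<union> (P \<inter> Q - D))" using that(2) eq by simp
    then have "card ((P - Q) \<union> (P \<inter> Q - D)) = card (P - Q) + card (P \<inter> Q - D)"
      by (intro card_Un_disjoint) auto
    then show ?thesis using eq by simp
  qed
  have "card (A - D) = card (A - B) + card (A \<inter> B - D)"
    "card (B - D) = card (B - A) + card (A \<inter> B - D)"
    using split[of B A] split[of A B] assms by (auto simp: Int_commute)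
  then show ?thesis by (simp add: excess_def)
qed

lemma excess_trans:
  assumes "almost_eq A B" "almost_eq B C"
  shows "excess A B + excess B C = excess A C"
proof -
  let ?D = "A \<inter> B \<inter> C"
  have "finite (sym_diff A B \<union> sym_diff B C)" using assms by (simp add: almost_eq_def)
  then have fin: "finite (A - ?D)" "finite (B - ?D)" "finite (C - ?D)"
    by (rule finite_subset[rotated], blast)+
  have "?D \<subseteq> A" "?D \<subseteq> B" "?D \<subseteq> C" by blast+
  with fin have "excess A B = int (card (A - ?D)) - int (card (B - ?D))"
    "excess B C = int (card (B - ?D)) - int (card (C - ?D))"
    "excess A C = int (card (A - ?D)) - int (card (C - ?D))"
    by (intro excess_eq_core; blast)+
  then show ?thesis by linarith
qed

lemma excess_swap: "excess B A = - excess A B"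
  by (simp add: excess_def)

lemma excess_compl:
  assumes "A \<subseteq> U" "B \<subseteq> U"
  shows "excess (U - A) (U - B) = - excess A B"
proof -
  have "(U - A) - (U - B) = B - A" "(U - B) - (U - A) = A - B" using assms by blast+
  then show ?thesis by (simp only: excess_def minus_diff_eq)
qed

lemma int_subgroup_generator:
  fixes D :: "int set"
  assumes diff: "\<And>x y. x \<in> D \<Longrightarrow> y \<in> D \<Longrightarrow> x - y \<in> D" and "x0 \<in> D" "x0 \<noteq> 0"
  obtains d where "d > 0" "D = range (\<lambda>q. q * d)"
proof -
  have zero: "0 \<in> D" using diff[of x0 x0] assms by simp
  have neg: "- x \<in> D" if "x \<in> D" for x using diff[OF zero that] by simp
  have add: "x + y \<in> D" if "x \<in> D" "y \<in> D" for x y using diff[OF that(1) neg[OF that(2)]] by simp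
  define P where "P n \<longleftrightarrow> n > 0 \<and> int n \<in> D" for n
  have "P (nat \<bar>x0\<bar>)" using assms neg[of x0] by (auto simp: P_def abs_if)
  then have dP: "P (Least P)" and least: "\<And>n. P n \<Longrightarrow> Least P \<le> n"
    by (auto intro: LeastI Least_le)
  define d where "d = int (Least P)"
  have d: "d > 0" "d \<in> D" using dP by (auto simp: P_def d_def)
  have mult: "int n * d \<in> D" for n
    by (induction n) (auto simp: zero algebra_simps intro: add d)
  have mult: "q * d \<in> D" for q
    by (cases q rule: int_cases2) (use mult neg in fastforce)+
  have "d dvd x" if "x \<in> D" for x
  proof (rule ccontr)
    assume "\<not> d dvd x"
    then have "x mod d > 0" using d(1) by (simp add: dvd_eq_mod_eq_0 order_less_le)
    moreover have "x mod d = x - (x div d) * d" by (simp add: minus_div_mult_eq_mod)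
    ultimately have "P (nat (x mod d))" using diff[OF that mult] by (simp add: P_def)
    then have "Least P \<le> nat (x mod d)" by (rule least)
    then have "d \<le> x mod d" unfolding d_def using \<open>x mod d > 0\<close> by (simp add: d_def le_nat_iff)
    then show False using pos_mod_bound[OF d(1), of x] by simp
  qed
  then have "D = range (\<lambda>q. q * d)" using mult by (force simp: dvd_def)
  with d that show thesis by blast
qed

lemma finite_byI:
  assumes "group G" "group Q" "h \<in> hom G Q" "carrier Q \<subseteq> h ` carrier G"
    and "finite {g \<in> carrier G. h g = \<one>\<^bsub>Q\<^esub>}"
  shows "finite_by G Q"
proof -
  interpret group_hom G Q h using assms by (simp add: group_hom_def group_hom_axioms_def)
  have "h ` carrier G = carrier Q" using assms(4) hom_closed by blast
  then have "G Mod kernel G Q h \<cong> Q" by (rule FactGroup_iso)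
  with assms(5) normal_kernel show ?thesis
    by (auto simp: finite_by_def kernel_def)
qed

context group
begin

lemma l_coset_eq_image: "g <# A = (\<lambda>x. g \<otimes> x) ` A"
  by (auto simp: l_coset_def)

lemma excess_translate:
  assumes "A \<subseteq> carrier G" "B \<subseteq> carrier G" "g \<in> carrier G"
  shows "excess (g <# A) (g <# B) = excess A B"
proof -
  have inj: "inj_on (\<lambda>x. g \<otimes> x) (carrier G)" using assms by (auto simp: inj_on_def)
  have "card ((g <# A) - (g <# B)) = card (A - B)" if "A \<subseteq> carrier G" "B \<subseteq> carrier G" for A B
  proof -
    have "(g <# A) - (g <# B) = (\<lambda>x. g \<otimes> x) ` (A - B)"
      unfolding l_coset_eq_image using that inj by (simp add: inj_on_image_set_diff[of _ "carrier G"] Diff_subset[THEN subset_trans])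
    then show ?thesis using that inj by (simp add: card_image inj_on_subset[OF inj] Diff_subset[THEN subset_trans])
  qed
  then show ?thesis using assms by (simp add: excess_def)
qed

lemma almost_eq_translate:
  assumes "almost_eq A B" "A \<subseteq> carrier G" "B \<subseteq> carrier G" "g \<in> carrier G"
  shows "almost_eq (g <# A) (g <# B)"
proof -
  have "sym_diff (g <# A) (g <# B) \<subseteq> (\<lambda>x. g \<otimes> x) ` sym_diff A B"
    unfolding l_coset_eq_image by blast
  with assms show ?thesis unfolding almost_eq_def by (meson finite_imageI finite_subset)
qed

lemma l_coset_compl:
  assumes "A \<subseteq> carrier G" "g \<in> carrier G"
  shows "g <# (carrier G - A) = carrier G - (g <# A)"
  using assms l_coset_carrier[of "carrier G - A" g] l_coset_carrier[of A g]
  by (auto simp: l_coset_mem_iff)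

definition almost_stabilizer :: "'a set \<Rightarrow> 'a set"
  where "almost_stabilizer X = {g \<in> carrier G. almost_eq (g <# X) X}"

text \<open>
  The transfer character of the action on an almost invariant set: shifting the positive half of
  \<open>\<int>\<close> by \<open>n\<close> gives displacement \<open>-n\<close>.
\<close>
definition displacement :: "'a set \<Rightarrow> 'a \<Rightarrow> int"
  where "displacement X g = excess (g <# X) X"

lemma subgroup_almost_stabilizer:
  assumes "X \<subseteq> carrier G"
  shows "subgroup (almost_stabilizer X) G"
proof (rule subgroupI)
  have "almost_eq (\<one> <# X) X" using assms by (simp add: lcos_mult_one almost_eq_refl)
  then show "almost_stabilizer X \<noteq> {}" by (auto simp: almost_stabilizer_def)
next
  fix g assume g: "g \<in> almost_stabilizer X"
  then have gc: "g \<in> carrier G" by (simp add: almost_stabilizer_def)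
  have "almost_eq (inv g <# (g <# X)) (inv g <# X)"
    using g assms gc l_coset_carrier[OF assms gc] by (intro almost_eq_translate) (auto simp: almost_stabilizer_def)
  then show "inv g \<in> almost_stabilizer X"
    using gc assms by (auto simp: almost_stabilizer_def lcos_m_assoc lcos_mult_one intro: almost_eq_sym)
next
  fix g h assume gh: "g \<in> almost_stabilizer X" "h \<in> almost_stabilizer X"
  then have c: "g \<in> carrier G" "h \<in> carrier G" by (auto simp: almost_stabilizer_def)
  have "almost_eq (g <# (h <# X)) (g <# X)"
    using gh assms c l_coset_carrier[OF assms c(2)] by (intro almost_eq_translate) (auto simp: almost_stabilizer_def)
  also have "almost_eq (g <# X) X" using gh by (simp add: almost_stabilizer_def)
  finally show "g \<otimes> h \<in> almost_stabilizer X"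
    using c assms by (auto simp: almost_stabilizer_def lcos_m_assoc)
qed (auto simp: almost_stabilizer_def)

text \<open>
  The excess of \<open>ghX\<close> over \<open>X\<close> splits at \<open>gX\<close>, and translating by \<open>g\<close> preserves the excess of
  \<open>hX\<close> over \<open>X\<close>.
\<close>
lemma displacement_mult:
  assumes X: "X \<subseteq> carrier G" and gh: "g \<in> almost_stabilizer X" "h \<in> almost_stabilizer X"
  shows "displacement X (g \<otimes> h) = displacement X g + displacement X h"
proof -
  have c: "g \<in> carrier G" "h \<in> carrier G" using gh by (auto simp: almost_stabilizer_def)
  have hX: "h <# X \<subseteq> carrier G" using l_coset_carrier[OF X c(2)] .
  have "almost_eq (g <# (h <# X)) (g <# X)"
    using gh X c hX by (intro almost_eq_translate) (auto simp: almost_stabilizer_def)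
  then have "excess (g <# (h <# X)) X = excess (g <# (h <# X)) (g <# X) + excess (g <# X) X"
    using gh by (subst excess_trans) (auto simp: almost_stabilizer_def)
  moreover have "excess (g <# (h <# X)) (g <# X) = excess (h <# X) X"
    using c X hX by (intro excess_translate)
  ultimately show ?thesis
    using c X by (simp add: displacement_def lcos_m_assoc)
qed

text \<open>
  \<open>F\<close> is the set of end points of the edges \<open>(x, xs)\<close> of the Cayley graph that leave \<open>X\<close>. For given
  \<open>e, e' \<in> F\<close>, commensuration on the right by \<open>e\<^sup>-\<^sup>1e'\<close> says that \<open>ge\<close> and \<open>ge'\<close> lie on the
  same side of \<open>X\<close> for all but finitely many \<open>g\<close>. Thus, apart from finitely many \<open>g\<close>, the set \<open>gF\<close> is
  on one side of \<open>X\<close> and \<open>F\<close> is on one side of \<open>gX\<close>. Of the four intersections of \<open>X\<close> or its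
  complement with \<open>gX\<close> or its complement, the one opposite to both of these sides then has no
  boundary edge, and so is empty as the Cayley graph is connected. As \<open>gX\<close> and \<open>X\<close> differ by a
  finite set only, this means that they are nested. If moreover the displacement is zero, then
  \<open>gX = X\<close>, so \<open>g\<close> permutes the finitely many edges that leave \<open>X\<close>, and it is determined by the
  image of one of them.
\<close>
lemma finite_displacement_kernel:
  assumes S: "S \<subseteq> carrier G" "finite S" "generate G S = carrier G"
    and rc: "right_commensurated X"
    and inf: "infinite X" "infinite (carrier G - X)"
  shows "finite {g \<in> almost_stabilizer X. displacement X g = 0}"
proof -
  have X: "X \<subseteq> carrier G" "\<And>g. g \<in> carrier G \<Longrightarrow> finite (right_jumps X g)"
    using rc by (auto simp: right_commensurated_def)
  define E where "E = (\<Union>s\<in>S. right_jumps X s)"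
  define F where "F = E \<union> (\<Union>s\<in>S. (\<lambda>x. x \<otimes> s) ` E)"
  have Ec: "E \<subseteq> carrier G" by (auto simp: E_def right_jumps_def)
  have Fc: "F \<subseteq> carrier G" using Ec S(1) by (auto simp: F_def)
  have finE: "finite E" using S X by (auto simp: E_def)
  have finF: "finite F" using finE S(2) by (auto simp: F_def)
  have connected: "Z = {} \<or> Z = carrier G"
    if Z: "Z \<subseteq> carrier G" "\<And>x s. x \<in> carrier G \<Longrightarrow> s \<in> S \<Longrightarrow> x \<in> Z \<longleftrightarrow> x \<otimes> s \<in> Z" for Z
  proof -
    have "\<one> \<otimes> h \<in> Z \<longleftrightarrow> \<one> \<in> Z" if h: "h \<in> carrier G" for h
    proof (rule no_jump_on_coset[OF S(1)])
      fix k s assume "k \<in> generate G S" "s \<in> S"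
      then show "\<one> \<otimes> k \<notin> right_jumps Z s"
        using Z(2)[of k s] S(3) by (auto simp: right_jumps_def)
    qed (simp_all add: h S(3))
    then have "h \<in> Z \<longleftrightarrow> \<one> \<in> Z" if "h \<in> carrier G" for h using that by (metis l_one)
    with Z(1) show ?thesis by blast
  qed
  have edge: "x \<in> F \<and> x \<otimes> s \<in> F" if "x \<in> carrier G" "s \<in> S" "(x \<in> X) \<noteq> (x \<otimes> s \<in> X)" for x s
    using that by (auto simp: F_def E_def right_jumps_def)
  obtain e0 s0 where e0: "s0 \<in> S" "e0 \<in> right_jumps X s0"
  proof -
    have "X \<noteq> {}" "X \<noteq> carrier G" using inf by auto
    have "\<exists>x s. x \<in> carrier G \<and> s \<in> S \<and> (x \<in> X) \<noteq> (x \<otimes> s \<in> X)"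
    proof (rule ccontr)
      assume "\<not> ?thesis"
      then have "X = {} \<or> X = carrier G" by (intro connected[OF X(1)]) blast
      with \<open>X \<noteq> {}\<close> \<open>X \<noteq> carrier G\<close> show False by blast
    qed
    then show thesis using that by (auto simp: right_jumps_def)
  qed
  define Bad where "Bad = {g \<in> carrier G. \<exists>e\<in>F. \<exists>e'\<in>F. (g \<otimes> e \<in> X) \<noteq> (g \<otimes> e' \<in> X)}"
  have finBad: "finite Bad"
  proof -
    have "finite {g \<in> carrier G. (g \<otimes> e \<in> X) \<noteq> (g \<otimes> e' \<in> X)}" (is "finite ?B")
      if "e \<in> F" "e' \<in> F" for e e'
    proof -
      have c: "e \<in> carrier G" "e' \<in> carrier G" using that Fc by auto
      have "?B \<subseteq> (\<lambda>x. x \<otimes> inv e) ` right_jumps X (inv e \<otimes> e')"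
      proof
        fix g assume g: "g \<in> ?B"
        then have "g \<otimes> e \<otimes> (inv e \<otimes> e') = g \<otimes> e'"
          using c by (simp add: m_assoc flip: m_assoc[of e "inv e" e'])
        then have "g \<otimes> e \<in> right_jumps X (inv e \<otimes> e')" using g c by (auto simp: right_jumps_def)
        moreover have "g = g \<otimes> e \<otimes> inv e" using g c by (simp add: m_assoc)
        ultimately show "g \<in> (\<lambda>x. x \<otimes> inv e) ` right_jumps X (inv e \<otimes> e')" by blast
      qed
      moreover have "finite (right_jumps X (inv e \<otimes> e'))" using X(2) c by simp
      ultimately show ?thesis using finite_surj by blast
    qed
    moreover have "Bad = (\<Union>e\<in>F. \<Union>e'\<in>F. {g \<in> carrier G. (g \<otimes> e \<in> X) \<noteq> (g \<otimes> e' \<in> X)})"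
      by (auto simp: Bad_def)
    ultimately show ?thesis using finF by simp
  qed
  have nested: "X \<subseteq> g <# X \<or> g <# X \<subseteq> X"
    if g: "g \<in> almost_stabilizer X" "g \<notin> Bad" "inv g \<notin> Bad" for g
  proof -
    have gc: "g \<in> carrier G" using g by (simp add: almost_stabilizer_def)
    have gXc: "g <# X \<subseteq> carrier G" using l_coset_carrier[OF X(1) gc] .
    have ae: "almost_eq (g <# X) X" using g by (simp add: almost_stabilizer_def)
    have inX: "e \<in> g <# X \<longleftrightarrow> inv g \<otimes> e \<in> X" if "e \<in> carrier G" for e
      by (rule l_coset_mem_iff[OF X(1) gc that])
    define a b where "a \<longleftrightarrow> (\<exists>e\<in>F. e \<in> g <# X)" and "b \<longleftrightarrow> (\<exists>e\<in>F. g \<otimes> e \<in> X)"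
    have "(e \<in> g <# X) = (e' \<in> g <# X)" if "e \<in> F" "e' \<in> F" for e e'
    proof -
      have "(inv g \<otimes> e \<in> X) = (inv g \<otimes> e' \<in> X)"
        using g(3) that gc unfolding Bad_def by blast
      then show ?thesis using inX[of e] inX[of e'] that Fc by blast
    qed
    then have a: "e \<in> g <# X \<longleftrightarrow> a" if "e \<in> F" for e
      using that unfolding a_def by blast
    have "(g \<otimes> e \<in> X) = (g \<otimes> e' \<in> X)" if "e \<in> F" "e' \<in> F" for e e'
      using g(2) that gc unfolding Bad_def by blast
    then have b: "g \<otimes> e \<in> X \<longleftrightarrow> b" if "e \<in> F" for e
      using that unfolding b_def by blast
    \<comment> \<open>the corner opposite to the sides \<open>a\<close> of \<open>F\<close> and \<open>b\<close> of \<open>gF\<close>\<close>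
    define Z where "Z = {x \<in> carrier G. (x \<in> g <# X) \<noteq> a \<and> (x \<in> X) \<noteq> b}"
    have "Z = {} \<or> Z = carrier G"
    proof (rule connected)
      fix x s assume xs: "x \<in> carrier G" "s \<in> S"
      then have s: "s \<in> carrier G" using S by auto
      have 1: "x \<notin> Z \<and> x \<otimes> s \<notin> Z" if "(x \<in> X) \<noteq> (x \<otimes> s \<in> X)"
        using edge[OF xs that] a[of x] a[of "x \<otimes> s"] by (simp add: Z_def)
      have 2: "x \<notin> Z \<and> x \<otimes> s \<notin> Z" if *: "(x \<in> g <# X) \<noteq> (x \<otimes> s \<in> g <# X)"
      proof -
        let ?y = "inv g \<otimes> x"
        have "(?y \<in> X) \<noteq> (?y \<otimes> s \<in> X)" using * xs s gc by (simp add: inX m_assoc)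
        then have y: "?y \<in> F" "?y \<otimes> s \<in> F" using edge[of ?y s] xs gc by auto
        have "g \<otimes> ?y = x" "g \<otimes> (?y \<otimes> s) = x \<otimes> s"
          using gc xs s by (simp_all flip: m_assoc)
        then have "x \<in> X \<longleftrightarrow> b" "x \<otimes> s \<in> X \<longleftrightarrow> b" using b[OF y(1)] b[OF y(2)] by simp_all
        then show ?thesis by (simp add: Z_def)
      qed
      show "x \<in> Z \<longleftrightarrow> x \<otimes> s \<in> Z"
      proof (cases "(x \<in> X) = (x \<otimes> s \<in> X) \<and> (x \<in> g <# X) = (x \<otimes> s \<in> g <# X)")
        case True
        then show ?thesis using xs s by (simp add: Z_def)
      next
        case False
        then show ?thesis using 1 2 by blast
      qed
    qed (auto simp: Z_def)
    moreover have "Z \<noteq> carrier G"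
    proof
      assume Z: "Z = carrier G"
      have "(x \<in> X) \<noteq> b" if "x \<in> carrier G" for x using Z that unfolding Z_def by blast
      then have "X = {} \<or> X = carrier G" using X(1) by blast
      then show False using inf by auto
    qed
    ultimately have "x \<notin> Z" for x by blast
    then have Z: "x \<in> g <# X \<longleftrightarrow> a" if "x \<in> carrier G" "(x \<in> X) \<noteq> b" for x
      using that unfolding Z_def by blast
    have fin: "finite (X - (g <# X))" "finite ((g <# X) - X)" using ae by (auto simp: almost_eq_def)
    show ?thesis
    proof (cases a; cases b)
      assume a b
      then have "carrier G - X \<subseteq> (g <# X) - X" using Z by blast
      then show ?thesis using fin inf finite_subset by blast
    next
      assume a "\<not> b"
      then show ?thesis using Z X(1) by blast
    next
      assume "\<not> a" b
      then show ?thesis using Z gXc by blast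
    next
      assume "\<not> a" "\<not> b"
      then have "X \<subseteq> X - (g <# X)" using Z X(1) by blast
      then show ?thesis using fin inf finite_subset by blast
    qed
  qed
  have "{g \<in> almost_stabilizer X. displacement X g = 0} \<subseteq>
      Bad \<union> m_inv G ` Bad \<union> (\<lambda>e. e \<otimes> inv e0) ` E"
  proof
    fix g assume "g \<in> {g \<in> almost_stabilizer X. displacement X g = 0}"
    then have g: "g \<in> almost_stabilizer X" "displacement X g = 0" and gc: "g \<in> carrier G"
      and ae: "almost_eq (g <# X) X" by (auto simp: almost_stabilizer_def)
    show "g \<in> Bad \<union> m_inv G ` Bad \<union> (\<lambda>e. e \<otimes> inv e0) ` E"
    proof (rule ccontr)
      assume no: "\<not> ?thesis"
      then have "g \<notin> Bad" "inv g \<notin> Bad" using gc by (auto simp: image_iff)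
      then have "X \<subseteq> g <# X \<or> g <# X \<subseteq> X" by (rule nested[OF g(1)])
      then have "X - (g <# X) = {} \<or> (g <# X) - X = {}" by blast
      moreover have "card ((g <# X) - X) = card (X - (g <# X))"
        using g(2) by (simp add: displacement_def excess_def)
      moreover have "finite (X - (g <# X))" "finite ((g <# X) - X)"
        using ae by (auto simp: almost_eq_def)
      ultimately have "X - (g <# X) = {} \<and> (g <# X) - X = {}" by (elim disjE) simp_all
      then have eq: "g <# X = X" by blast
      have inv: "g \<otimes> y \<in> X \<longleftrightarrow> y \<in> X" if "y \<in> carrier G" for y
        using l_coset_mem_iff[OF X(1) gc, of "g \<otimes> y"] eq that gc by (simp flip: m_assoc)
      have e0c: "e0 \<in> carrier G" "s0 \<in> carrier G" using e0 S by (auto simp: right_jumps_def)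
      have "g \<otimes> e0 \<in> right_jumps X s0"
        using e0 inv[of e0] inv[of "e0 \<otimes> s0"] e0c gc by (simp add: right_jumps_def m_assoc)
      then have "g \<otimes> e0 \<in> E" using e0 by (auto simp: E_def)
      moreover have "g = g \<otimes> e0 \<otimes> inv e0" using gc e0c by (simp add: m_assoc)
      ultimately show False using no by blast
    qed
  qed
  then show ?thesis using finBad finE finite_subset by blast
qed

end

section \<open>Homomorphisms onto the integers and the infinite dihedral group\<close>

context group
begin

text \<open>
  The displacement of \<open>sgs\<^sup>-\<^sup>1\<close> on \<open>X\<close> is that of \<open>g\<close> on \<open>s\<^sup>-\<^sup>1X\<close>. A finite change of the set does
  not affect the displacement, so the complement of \<open>X\<close> may replace \<open>s\<^sup>-\<^sup>1X\<close>, and passing to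
  complements reverses the sign.
\<close>
lemma displacement_conjugate:
  assumes X: "X \<subseteq> carrier G" and s: "s \<in> carrier G"
    and flip: "almost_eq (inv s <# X) (carrier G - X)" and g: "g \<in> almost_stabilizer X"
  shows "s \<otimes> g \<otimes> inv s \<in> almost_stabilizer X"
    and "displacement X (s \<otimes> g \<otimes> inv s) = - displacement X g"
proof -
  let ?Y = "inv s <# X" and ?C = "carrier G - X"
  have gc: "g \<in> carrier G" and ae: "almost_eq (g <# X) X"
    using g by (auto simp: almost_stabilizer_def)
  have gXc: "g <# X \<subseteq> carrier G" by (rule l_coset_carrier[OF X gc])
  have Y: "?Y \<subseteq> carrier G" by (rule l_coset_carrier[OF X inv_closed[OF s]])
  have gY: "g <# ?Y \<subseteq> carrier G" by (rule l_coset_carrier[OF Y gc])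
  have C: "?C \<subseteq> carrier G" by blast
  have gC: "g <# ?C = carrier G - (g <# X)" by (rule l_coset_compl[OF X gc])
  have 1: "almost_eq (g <# ?Y) (g <# ?C)" by (rule almost_eq_translate[OF flip Y C gc])
  have 2: "almost_eq (g <# ?C) ?C" unfolding gC by (rule almost_eq_compl[OF ae])
  have 3: "almost_eq ?C ?Y" by (rule almost_eq_sym[OF flip])
  have 12: "almost_eq (g <# ?Y) ?C" by (rule almost_eq_trans[OF 1 2])
  have 123: "almost_eq (g <# ?Y) ?Y" by (rule almost_eq_trans[OF 12 3])
  have "excess (g <# ?Y) ?Y = excess (g <# ?Y) (g <# ?C) + excess (g <# ?C) ?C + excess ?C ?Y"
    using excess_trans[OF 1 2] excess_trans[OF 12 3] by simp
  also have "excess (g <# ?Y) (g <# ?C) = excess ?Y ?C" by (rule excess_translate[OF Y C gc])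
  also have "\<dots> = - excess ?C ?Y" by (rule excess_swap)
  also have "excess (g <# ?C) ?C = - displacement X g"
    unfolding gC displacement_def by (rule excess_compl[OF gXc X])
  finally have ex: "excess (g <# ?Y) ?Y = - displacement X g" by simp
  have "g \<otimes> inv s <# X = g <# ?Y" using X gc s by (simp add: lcos_m_assoc)
  then have e1: "s \<otimes> g \<otimes> inv s <# X = s <# (g <# ?Y)"
    using X gc s gY by (simp add: m_assoc flip: lcos_m_assoc)
  have e2: "s <# ?Y = X" using X s by (simp add: lcos_m_assoc lcos_mult_one)
  have "almost_eq (s <# (g <# ?Y)) (s <# ?Y)" by (rule almost_eq_translate[OF 123 gY Y s])
  then show "s \<otimes> g \<otimes> inv s \<in> almost_stabilizer X"
    using gc s by (simp add: almost_stabilizer_def e1 e2)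
  have "excess (s <# (g <# ?Y)) (s <# ?Y) = excess (g <# ?Y) ?Y"
    by (rule excess_translate[OF gY Y s])
  then show "displacement X (s \<otimes> g \<otimes> inv s) = - displacement X g"
    by (simp add: displacement_def[of X "s \<otimes> g \<otimes> inv s"] e1 e2 ex)
qed

lemma almost_stabilizer_mult_flips:
  assumes X: "X \<subseteq> carrier G"
    and dich: "\<forall>g \<in> carrier G. almost_eq (g <# X) X \<or> almost_eq (g <# X) (carrier G - X)"
    and g: "g \<in> carrier G" "g \<notin> almost_stabilizer X"
    and h: "h \<in> carrier G" "h \<notin> almost_stabilizer X"
  shows "g \<otimes> h \<in> almost_stabilizer X"
proof -
  let ?C = "carrier G - X"
  have gX: "almost_eq (g <# X) ?C" and hX: "almost_eq (h <# X) ?C"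
    using dich g h by (auto simp: almost_stabilizer_def)
  have "almost_eq (g <# (h <# X)) (g <# ?C)"
    using l_coset_carrier[OF X h(1)] by (intro almost_eq_translate[OF hX]) (use g in auto)
  also have "g <# ?C = carrier G - (g <# X)" by (rule l_coset_compl[OF X g(1)])
  also have "almost_eq (carrier G - (g <# X)) (carrier G - ?C)" by (rule almost_eq_compl[OF gX])
  also have "carrier G - ?C = X" using X by blast
  finally show ?thesis using g h X by (simp add: almost_stabilizer_def lcos_m_assoc)
qed

text \<open>
  The almost stabilizer has index at most two, hence is infinite, and the displacement on it has a
  finite kernel. So its values form a subgroup \<open>d\<int>\<close> with \<open>d > 0\<close>, and dividing by \<open>d\<close> makes it
  onto.
\<close>
lemma normalized_displacement:
  assumes S: "S \<subseteq> carrier G" "finite S" "generate G S = carrier G"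
    and rc: "right_commensurated X"
    and inf: "infinite X" "infinite (carrier G - X)"
    and dich: "\<forall>g \<in> carrier G. almost_eq (g <# X) X \<or> almost_eq (g <# X) (carrier G - X)"
  obtains d and f :: "'a \<Rightarrow> int"
  where "d > 0" "\<forall>g \<in> almost_stabilizer X. displacement X g = f g * d"
    "\<forall>g \<in> almost_stabilizer X. \<forall>h \<in> almost_stabilizer X. f (g \<otimes> h) = f g + f h"
    "f ` almost_stabilizer X = UNIV" "finite {g \<in> almost_stabilizer X. f g = 0}"
proof -
  let ?K = "almost_stabilizer X"
  have X: "X \<subseteq> carrier G" using rc by (simp add: right_commensurated_def)
  interpret K: subgroup ?K G by (rule subgroup_almost_stabilizer[OF X])
  note ker = finite_displacement_kernel[OF S rc inf]
  have infG: "infinite (carrier G)" using inf(1) X finite_subset by blast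
  have infK: "infinite ?K"
  proof
    assume fin: "finite ?K"
    obtain s where s: "s \<in> carrier G" "s \<notin> ?K"
      using fin infG K.subset by (metis subsetI subset_antisym)
    have "carrier G \<subseteq> ?K \<union> (\<lambda>g. g \<otimes> inv s) ` ?K"
    proof
      fix g assume g: "g \<in> carrier G"
      show "g \<in> ?K \<union> (\<lambda>g. g \<otimes> inv s) ` ?K"
      proof (cases "g \<in> ?K")
        case False
        then have "g \<otimes> s \<in> ?K" using almost_stabilizer_mult_flips[OF X dich g False s] by blast
        moreover have "g = g \<otimes> s \<otimes> inv s" using g s by (simp add: m_assoc)
        ultimately show ?thesis by blast
      qed simp
    qed
    then show False using fin infG finite_subset by blast
  qed
  have "infinite (?K - {g \<in> ?K. displacement X g = 0})"
    using infK ker by (rule Diff_infinite_finite[rotated])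
  then obtain g0 where g0: "g0 \<in> ?K" "displacement X g0 \<noteq> 0"
    using infinite_imp_nonempty by blast
  have add: "displacement X (g \<otimes> h) = displacement X g + displacement X h"
    if "g \<in> ?K" "h \<in> ?K" for g h
    by (rule displacement_mult[OF X that])
  have diff: "x - y \<in> displacement X ` ?K"
    if xy: "x \<in> displacement X ` ?K" "y \<in> displacement X ` ?K" for x y
  proof -
    obtain g where g: "x = displacement X g" "g \<in> ?K" using xy(1) by (rule imageE)
    obtain h where h: "y = displacement X h" "h \<in> ?K" using xy(2) by (rule imageE)
    have gh: "g \<otimes> inv h \<in> ?K" using g h by simp
    have c: "g \<in> carrier G" "h \<in> carrier G" using g h K.mem_carrier by auto
    then have "g \<otimes> inv h \<otimes> h = g" by (simp add: m_assoc)
    then have "x - y = displacement X (g \<otimes> inv h)"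
      using add[OF gh h(2)] g(1) h(1) by simp
    then show ?thesis using gh by (rule image_eqI)
  qed
  obtain d where d: "d > 0" "displacement X ` ?K = range (\<lambda>q. q * d)"
    using int_subgroup_generator[OF diff imageI[OF g0(1)] g0(2)] by blast
  define f where "f g = displacement X g div d" for g
  have f: "displacement X g = f g * d" if "g \<in> ?K" for g
  proof -
    have "displacement X g \<in> range (\<lambda>q. q * d)" using d(2) that by blast
    then show ?thesis using d(1) by (auto simp: f_def)
  qed
  show thesis
  proof (rule that[OF d(1)])
    show "\<forall>g\<in>?K. displacement X g = f g * d" using f by blast
  next
    have "f (g \<otimes> h) = f g + f h" if gh: "g \<in> ?K" "h \<in> ?K" for g h
    proof -
    have "f (g \<otimes> h) * d = (f g + f h) * d"
      using add[OF gh] gh by (simp add: f[symmetric] distrib_right)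
    then show "f (g \<otimes> h) = f g + f h" using d(1) by simp
    qed
    then show "\<forall>g\<in>?K. \<forall>h\<in>?K. f (g \<otimes> h) = f g + f h" by blast
  next
    have "n \<in> f ` ?K" for n
    proof -
      have "n * d \<in> displacement X ` ?K" unfolding d(2) by blast
      then obtain g where "g \<in> ?K" "displacement X g = n * d" by auto
      moreover then have "f g = n" using d(1) by (simp add: f_def)
      ultimately show ?thesis by blast
    qed
    then show "f ` ?K = UNIV" by blast
  next
    have "{g \<in> ?K. f g = 0} \<subseteq> {g \<in> ?K. displacement X g = 0}" using f by auto
    then show "finite {g \<in> ?K. f g = 0}" using ker finite_subset by blast
  qed
qed

lemma finite_by_integer_if_stabilized:
  assumes S: "S \<subseteq> carrier G" "finite S" "generate G S = carrier G"
    and rc: "right_commensurated X"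
    and inf: "infinite X" "infinite (carrier G - X)"
    and stab: "almost_stabilizer X = carrier G"
  shows "finite_by G integer_group"
proof -
  have dich: "\<forall>g \<in> carrier G. almost_eq (g <# X) X \<or> almost_eq (g <# X) (carrier G - X)"
    using stab by (auto simp: almost_stabilizer_def)
  obtain d :: int and f where f: "d > 0"
    "\<forall>g \<in> almost_stabilizer X. displacement X g = f g * d"
    "\<forall>g \<in> almost_stabilizer X. \<forall>h \<in> almost_stabilizer X. f (g \<otimes> h) = f g + f h"
    "f ` almost_stabilizer X = UNIV" "finite {g \<in> almost_stabilizer X. f g = 0}"
    by (rule normalized_displacement[OF S rc inf dich]) 
  show ?thesis
  proof (rule finite_byI[of _ _ f])
    show "f \<in> hom G integer_group" using f(3) by (auto simp: hom_def stab)
  qed (use f stab in \<open>auto intro: group_axioms\<close>)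
qed

text \<open>
  An element \<open>s\<close> that exchanges \<open>X\<close> and its complement plays the role of a reflection: conjugation
  by \<open>s\<close> changes the sign of the normalized displacement \<open>f\<close>, so \<open>f(s\<^sup>2) = - f(s\<^sup>2)\<close> vanishes.
  Sending \<open>g\<close> to \<open>(f(g), False)\<close> and \<open>gs\<close> to \<open>(f(g), True)\<close> for \<open>g\<close> in the almost stabilizer is
  therefore a homomorphism onto \<open>D\<^sub>\<infinity>\<close> with the same kernel as \<open>f\<close>.
\<close>
lemma finite_by_dihedral_if_flipped:
  assumes S: "S \<subseteq> carrier G" "finite S" "generate G S = carrier G"
    and rc: "right_commensurated X"
    and inf: "infinite X" "infinite (carrier G - X)"
    and dich: "\<forall>g \<in> carrier G. almost_eq (g <# X) X \<or> almost_eq (g <# X) (carrier G - X)"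
    and s: "s \<in> carrier G" "s \<notin> almost_stabilizer X"
  shows "finite_by G infinite_dihedral_group"
proof -
  let ?K = "almost_stabilizer X"
  have X: "X \<subseteq> carrier G" using rc by (simp add: right_commensurated_def)
  interpret K: subgroup ?K G by (rule subgroup_almost_stabilizer[OF X])
  obtain d :: int and f where d: "d > 0" and fd': "\<forall>g\<in>?K. displacement X g = f g * d"
    and add': "\<forall>g\<in>?K. \<forall>h\<in>?K. f (g \<otimes> h) = f g + f h"
    and onto: "f ` ?K = UNIV" and ker: "finite {g \<in> ?K. f g = 0}"
    by (rule normalized_displacement[OF S rc inf dich])
  have add: "f (g \<otimes> h) = f g + f h" if "g \<in> ?K" "h \<in> ?K" for g h using add' that by blast
  have fd: "displacement X g = f g * d" if "g \<in> ?K" for g using fd' that by blast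
  have flips: "g \<otimes> h \<in> ?K" if "g \<in> carrier G" "g \<notin> ?K" "h \<in> carrier G" "h \<notin> ?K" for g h
    by (rule almost_stabilizer_mult_flips[OF X dich that])
  have mixed1: "g \<otimes> h \<notin> ?K" if "g \<in> ?K" "h \<in> carrier G" "h \<notin> ?K" for g h
  proof
    assume "g \<otimes> h \<in> ?K"
    then have "inv g \<otimes> (g \<otimes> h) \<in> ?K" using that by blast
    then show False using that K.mem_carrier by (simp flip: m_assoc)
  qed
  have mixed2: "g \<otimes> h \<notin> ?K" if "g \<in> carrier G" "g \<notin> ?K" "h \<in> ?K" for g h
  proof
    assume "g \<otimes> h \<in> ?K"
    then have "g \<otimes> h \<otimes> inv h \<in> ?K" using that by blast
    then show False using that K.mem_carrier by (simp add: m_assoc)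
  qed
  have s': "inv s \<notin> ?K" using s K.m_inv_closed[of "inv s"] by auto
  have flip: "almost_eq (inv s <# X) (carrier G - X)"
  proof -
    have c: "inv s \<in> carrier G" using s by simp
    then have "\<not> almost_eq (inv s <# X) X" using s' unfolding almost_stabilizer_def by blast
    then show ?thesis using bspec[OF dich c] by blast
  qed
  have unflip: "g \<otimes> inv s \<in> ?K" if "g \<in> carrier G" "g \<notin> ?K" for g
    using flips[OF that _ s'] s by simp
  have conj: "s \<otimes> g \<otimes> inv s \<in> ?K" "f (s \<otimes> g \<otimes> inv s) = - f g" if "g \<in> ?K" for g
  proof -
    show c: "s \<otimes> g \<otimes> inv s \<in> ?K" by (rule displacement_conjugate(1)[OF X s(1) flip that])
    have "f (s \<otimes> g \<otimes> inv s) * d = - f g * d"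
      using displacement_conjugate(2)[OF X s(1) flip that] fd[OF c] fd[OF that] by simp
    then show "f (s \<otimes> g \<otimes> inv s) = - f g"
      using d mult_right_cancel[of d "f (s \<otimes> g \<otimes> inv s)" "- f g"] by blast
  qed
  have ss: "s \<otimes> s \<in> ?K" by (rule flips[OF s s])
  have "s \<otimes> (s \<otimes> s) \<otimes> inv s = s \<otimes> s" using s by (simp add: m_assoc)
  then have fss: "f (s \<otimes> s) = 0" using conj(2)[OF ss] by simp
  define F where "F g = (if g \<in> ?K then (f g, False) else (f (g \<otimes> inv s), True))" for g
  show ?thesis
  proof (rule finite_byI[of _ _ F])
    show "F \<in> hom G infinite_dihedral_group"
    proof (rule homI)
      fix g h assume gh: "g \<in> carrier G" "h \<in> carrier G"
      show "F (g \<otimes> h) = F g \<otimes>\<^bsub>infinite_dihedral_group\<^esub> F h"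
      proof (cases "g \<in> ?K"; cases "h \<in> ?K")
        assume "g \<in> ?K" "h \<in> ?K"
        then show ?thesis using add by (simp add: F_def infinite_dihedral_group_def)
      next
        assume *: "g \<in> ?K" "h \<notin> ?K"
        have "f (g \<otimes> h \<otimes> inv s) = f g + f (h \<otimes> inv s)"
          using add[OF *(1) unflip[OF gh(2) *(2)]] gh s by (simp add: m_assoc)
        then show ?thesis
          using * mixed1[OF *(1) gh(2) *(2)] by (simp add: F_def infinite_dihedral_group_def)
      next
        assume *: "g \<notin> ?K" "h \<in> ?K"
        have "g \<otimes> h \<otimes> inv s = (g \<otimes> inv s) \<otimes> (s \<otimes> h \<otimes> inv s)"
          using gh s by (simp add: m_assoc flip: m_assoc[of "inv s" s])
        then have "f (g \<otimes> h \<otimes> inv s) = f (g \<otimes> inv s) - f h"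
          using add[OF unflip[OF gh(1) *(1)] conj(1)[OF *(2)]] conj(2)[OF *(2)] by simp
        then show ?thesis
          using * mixed2[OF gh(1) *] by (simp add: F_def infinite_dihedral_group_def)
      next
        assume *: "g \<notin> ?K" "h \<notin> ?K"
        let ?g = "g \<otimes> inv s" and ?h = "h \<otimes> inv s"
        have K: "?g \<in> ?K" "?h \<in> ?K" using unflip gh * by auto
        have "g \<otimes> h = ?g \<otimes> (s \<otimes> ?h \<otimes> inv s) \<otimes> (s \<otimes> s)"
          using gh s by (simp add: m_assoc flip: m_assoc[of "inv s" s])
        then have "f (g \<otimes> h) = f ?g - f ?h"
          using add[OF _ ss, of "?g \<otimes> (s \<otimes> ?h \<otimes> inv s)"] add[OF K(1) conj(1)[OF K(2)]]
            conj[OF K(2)] K fss by simp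
        then show ?thesis
          using * flips[OF gh(1) *(1) gh(2) *(2)] by (simp add: F_def infinite_dihedral_group_def)
      qed
    qed (simp add: infinite_dihedral_group_def)
    show "carrier infinite_dihedral_group \<subseteq> F ` carrier G"
    proof (clarsimp)
      fix n b
      obtain g where g: "g \<in> ?K" "f g = n" using onto by (metis UNIV_I imageE)
      have gc: "g \<in> carrier G" using g K.mem_carrier by blast
      show "(n, b) \<in> F ` carrier G"
      proof (cases b)
        case True
        have "g \<otimes> s \<notin> ?K" by (rule mixed1[OF g(1) s])
        then have "F (g \<otimes> s) = (n, b)" using True g gc s by (simp add: F_def m_assoc)
        then show ?thesis using gc s by (metis m_closed imageI)
      next
        case False
        then have "F g = (n, b)" using g by (simp add: F_def)
        then show ?thesis using gc by (metis imageI)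
      qed
    qed
    have "{g \<in> carrier G. F g = \<one>\<^bsub>infinite_dihedral_group\<^esub>} \<subseteq> {g \<in> ?K. f g = 0}"
      by (auto simp: F_def infinite_dihedral_group_def split: if_splits)
    then show "finite {g \<in> carrier G. F g = \<one>\<^bsub>infinite_dihedral_group\<^esub>}"
      using ker finite_subset by blast
  qed (simp_all add: group_axioms group_infinite_dihedral_group)
qed

end

section \<open>Height functions\<close>

text \<open>
  This covers two situations: \<open>k\<close> may be a homomorphism to \<open>\<int>\<close> with finite kernel and \<open>k(c) = 1\<close>,
  or \<open>c\<close> may generate a subgroup of finite index isomorphic to \<open>\<int>\<close>, with \<open>k\<close> reading off the
  exponent of \<open>c\<close> relative to representatives of the right cosets.
\<close>
locale height_function = group G for G (structure) +
  fixes c :: 'a and k :: "'a \<Rightarrow> int"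
  assumes c_closed: "c \<in> carrier G"
    and height_c: "x \<in> carrier G \<Longrightarrow> k (c \<otimes> x) = k x + 1"
    and finite_level_0: "finite {x \<in> carrier G. k x = 0}"
    and height_right: "g \<in> carrier G \<Longrightarrow> \<exists>M. \<forall>x \<in> carrier G. \<bar>k (x \<otimes> g) - k x\<bar> \<le> M"
begin

lemma height_pow:
  assumes "x \<in> carrier G"
  shows "k (c [^] (n::int) \<otimes> x) = k x + n"
proof -
  have nat: "k (c [^] m \<otimes> y) = k y + int m" if "y \<in> carrier G" for m :: nat and y
    using that
  proof (induction m)
    case (Suc m)
    have "c [^] Suc m \<otimes> y = c \<otimes> (c [^] m \<otimes> y)"
      using Suc.prems c_closed by (subst nat_pow_Suc2) (simp_all add: m_assoc)
    then show ?case using Suc c_closed height_c[of "c [^] m \<otimes> y"] by simp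
  qed simp
  show ?thesis
  proof (cases n rule: int_cases2)
    case (nonneg m)
    then show ?thesis using nat[OF assms] by (simp add: int_pow_int)
  next
    case (nonpos m)
    let ?y = "c [^] n \<otimes> x"
    have y: "?y \<in> carrier G" using assms c_closed by simp
    have "c [^] (int m) \<otimes> ?y = x"
      using assms c_closed nonpos by (simp add: int_pow_neg flip: m_assoc)
    then show ?thesis using nat[OF y, of m] nonpos by (simp add: int_pow_int)
  qed
qed

lemma finite_heights:
  "finite {x \<in> carrier G. \<bar>k x\<bar> \<le> M}"
proof -
  have "finite {x \<in> carrier G. k x = n}" for n
  proof -
    have "{x \<in> carrier G. k x = n} \<subseteq> (\<lambda>x. c [^] n \<otimes> x) ` {x \<in> carrier G. k x = 0}"
    proof
      fix x assume x: "x \<in> {x \<in> carrier G. k x = n}"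
      have "c [^] n \<otimes> (c [^] (- n) \<otimes> x) = x"
        using x c_closed by (simp add: int_pow_neg flip: m_assoc)
      moreover have "c [^] (- n) \<otimes> x \<in> {x \<in> carrier G. k x = 0}"
        using x c_closed height_pow[of x "- n"] by simp
      ultimately show "x \<in> (\<lambda>x. c [^] n \<otimes> x) ` {x \<in> carrier G. k x = 0}"
        by (metis imageI)
    qed
    then show ?thesis using finite_level_0 by (meson finite_imageI finite_subset)
  qed
  then have "finite (\<Union>n\<in>{- M..M}. {x \<in> carrier G. k x = n})" by blast
  moreover have "{x \<in> carrier G. \<bar>k x\<bar> \<le> M} \<subseteq> (\<Union>n\<in>{- M..M}. {x \<in> carrier G. k x = n})"
    by auto
  ultimately show ?thesis by (rule finite_subset[rotated])
qed

lemma height_onto: "\<exists>x \<in> carrier G. k x = n"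
  using height_pow[of \<one> "n - k \<one>"] c_closed by (intro bexI[of _ "c [^] (n - k \<one>) \<otimes> \<one>"]) auto

definition positive :: "'a set" where "positive = {x \<in> carrier G. k x > 0}"

definition nonpositive :: "'a set" where "nonpositive = {x \<in> carrier G. k x \<le> 0}"

lemma nonpositive_eq: "nonpositive = carrier G - positive"
  by (auto simp: positive_def nonpositive_def)

lemma infinite_halves: "infinite positive" "infinite nonpositive"
proof -
  have "{1..} \<subseteq> k ` positive"
  proof
    fix n :: int assume "n \<in> {1..}"
    then show "n \<in> k ` positive" using height_onto[of n] by (auto simp: positive_def)
  qed
  then show "infinite positive" using infinite_Ici[of "1::int"] finite_subset by blast
  have "{..0} \<subseteq> k ` nonpositive"
  proof
    fix n :: int assume "n \<in> {..0}"
    then show "n \<in> k ` nonpositive" using height_onto[of n] by (auto simp: nonpositive_def)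
  qed
  then show "infinite nonpositive" using infinite_Iic[of "0::int"] finite_subset by blast
qed

lemma right_commensurated_positive: "right_commensurated positive"
  unfolding right_commensurated_def
proof (intro conjI ballI)
  fix g assume g: "g \<in> carrier G"
  obtain M where M: "\<forall>x \<in> carrier G. \<bar>k (x \<otimes> g) - k x\<bar> \<le> M" using height_right[OF g] by blast
  have "right_jumps positive g \<subseteq> {x \<in> carrier G. \<bar>k x\<bar> \<le> M}"
  proof
    fix x assume x: "x \<in> right_jumps positive g"
    then have xc: "x \<in> carrier G" by (simp add: right_jumps_def)
    with x g have "(k x > 0) \<noteq> (k (x \<otimes> g) > 0)" by (simp add: right_jumps_def positive_def)
    moreover have "\<bar>k (x \<otimes> g) - k x\<bar> \<le> M" using M xc by blast
    ultimately show "x \<in> {x \<in> carrier G. \<bar>k x\<bar> \<le> M}" using xc by auto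
  qed
  then show "finite (right_jumps positive g)" using finite_heights finite_subset by blast
qed (auto simp: positive_def)

text \<open>
  Every element is \<open>c\<^sup>nr\<close> with \<open>r\<close> in the finite set of elements of height \<open>0\<close>. Right multiplication
  by \<open>r\<^sup>-\<^sup>1r\<^sub>0\<close> moves \<open>c\<^sup>nr\<close> to \<open>c\<^sup>nr\<^sub>0\<close>, and right multiplication by \<open>r\<^sub>0\<^sup>-\<^sup>1cr\<^sub>0\<close> moves
  \<open>c\<^sup>nr\<^sub>0\<close> to \<open>c\<^sup>n\<^sup>+\<^sup>1r\<^sub>0\<close>. The finitely many jumps of \<open>Y\<close> along these elements have bounded
  height, so beyond that bound membership in \<open>Y\<close> depends on the sign of the height only.
\<close>
lemma right_commensurated_eventually_constant:
  assumes Y: "right_commensurated Y"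
  obtains M where "M > 0"
    "\<forall>x \<in> carrier G. \<forall>y \<in> carrier G. k x \<ge> M \<longrightarrow> k y \<ge> M \<longrightarrow> (x \<in> Y \<longleftrightarrow> y \<in> Y)"
    "\<forall>x \<in> carrier G. \<forall>y \<in> carrier G. k x \<le> - M \<longrightarrow> k y \<le> - M \<longrightarrow> (x \<in> Y \<longleftrightarrow> y \<in> Y)"
proof -
  let ?L = "{x \<in> carrier G. k x = 0}"
  obtain r0 where r0: "r0 \<in> carrier G" "k r0 = 0" using height_onto by blast
  define B where "B = right_jumps Y (inv r0 \<otimes> c \<otimes> r0) \<union> (\<Union>r\<in>?L. right_jumps Y (inv r \<otimes> r0))"
  have "finite (right_jumps Y (inv r \<otimes> r0))" if "r \<in> ?L" for r
    using Y that r0 by (auto simp: right_commensurated_def)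
  moreover have "finite (right_jumps Y (inv r0 \<otimes> c \<otimes> r0))"
    using Y r0 c_closed by (auto simp: right_commensurated_def)
  ultimately have finB: "finite B" using finite_level_0 by (simp add: B_def)
  define M where "M = Max (insert 0 ((\<lambda>x. \<bar>k x\<bar>) ` B)) + 1"
  have M0: "M > 0" using finB Max_ge[of "insert 0 ((\<lambda>x. \<bar>k x\<bar>) ` B)" 0] unfolding M_def by simp
  have MB: "x \<notin> B" if "\<bar>k x\<bar> \<ge> M" for x
  proof
    assume "x \<in> B"
    then have "\<bar>k x\<bar> \<le> Max (insert 0 ((\<lambda>x. \<bar>k x\<bar>) ` B))" using finB by (intro Max_ge) auto
    with that show False by (simp add: M_def)
  qed
  define a where "a n \<longleftrightarrow> c [^] (n::int) \<otimes> r0 \<in> Y" for n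
  have to_a: "x \<in> Y \<longleftrightarrow> a (k x)" if x: "x \<in> carrier G" "\<bar>k x\<bar> \<ge> M" for x
  proof -
    let ?r = "c [^] (- k x) \<otimes> x"
    have r: "?r \<in> ?L" using x c_closed height_pow[of x "- k x"] by simp
    have "x \<otimes> (inv ?r \<otimes> r0) = c [^] (k x) \<otimes> r0"
    proof -
      have "c [^] (k x) \<otimes> ?r = x"
        using x c_closed by (simp add: int_pow_neg flip: m_assoc)
      then have "x \<otimes> (inv ?r \<otimes> r0) = c [^] (k x) \<otimes> ?r \<otimes> (inv ?r \<otimes> r0)" by simp
      also have "\<dots> = c [^] (k x) \<otimes> (?r \<otimes> inv ?r) \<otimes> r0"
        using r r0 c_closed by (simp only: m_assoc int_pow_closed inv_closed m_closed mem_Collect_eq)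
      also have "\<dots> = c [^] (k x) \<otimes> r0" using r r0 c_closed by (simp only: r_inv r_one int_pow_closed mem_Collect_eq)
      finally show ?thesis .
    qed
    moreover have "x \<notin> right_jumps Y (inv ?r \<otimes> r0)" using MB[OF x(2)] r unfolding B_def by blast
    ultimately show ?thesis using x(1) by (simp add: right_jumps_def a_def)
  qed
  have step: "a n \<longleftrightarrow> a (n + 1)" if n: "\<bar>n\<bar> \<ge> M" for n
  proof -
    let ?x = "c [^] n \<otimes> r0"
    have xc: "?x \<in> carrier G" using c_closed r0 by simp
    have "?x \<otimes> (inv r0 \<otimes> c \<otimes> r0) = c [^] n \<otimes> (r0 \<otimes> inv r0) \<otimes> c \<otimes> r0"
      using c_closed r0 by (simp only: m_assoc int_pow_closed inv_closed m_closed)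
    also have "\<dots> = c [^] (n + 1) \<otimes> r0"
      using c_closed r0 by (simp add: int_pow_mult)
    finally have "?x \<otimes> (inv r0 \<otimes> c \<otimes> r0) = c [^] (n + 1) \<otimes> r0" .
    moreover have "k ?x = n" using height_pow[OF r0(1)] r0(2) by simp
    then have "?x \<notin> B" using MB n by simp
    then have "?x \<notin> right_jumps Y (inv r0 \<otimes> c \<otimes> r0)" unfolding B_def by blast
    ultimately show ?thesis using xc by (simp add: right_jumps_def a_def)
  qed
  have up: "a n \<longleftrightarrow> a M" if "n \<ge> M" for n
    using that
  proof (induction n rule: int_ge_induct)
    case (step i)
    then show ?case using \<open>\<And>n. \<bar>n\<bar> \<ge> M \<Longrightarrow> a n \<longleftrightarrow> a (n + 1)\<close>[of i] M0 by simp
  qed simp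
  have down: "a n \<longleftrightarrow> a (- M)" if "n \<le> - M" for n
    using that
  proof (induction n rule: int_le_induct)
    case (step i)
    then show ?case using \<open>\<And>n. \<bar>n\<bar> \<ge> M \<Longrightarrow> a n \<longleftrightarrow> a (n + 1)\<close>[of "i - 1"] M0 by simp
  qed simp
  show thesis
  proof (rule that[OF M0]; intro ballI impI)
    fix x y assume "x \<in> carrier G" "y \<in> carrier G" "k x \<ge> M" "k y \<ge> M"
    then show "x \<in> Y \<longleftrightarrow> y \<in> Y" using to_a[of x] to_a[of y] up[of "k x"] up[of "k y"] by simp
  next
    fix x y assume "x \<in> carrier G" "y \<in> carrier G" "k x \<le> - M" "k y \<le> - M"
    then show "x \<in> Y \<longleftrightarrow> y \<in> Y" using to_a[of x] to_a[of y] down[of "k x"] down[of "k y"] by simp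
  qed
qed

lemma right_commensurated_halves:
  assumes Y: "right_commensurated Y"
  shows "finite (Y \<inter> positive) \<or> finite (positive - Y)"
    and "finite (Y \<inter> nonpositive) \<or> finite (nonpositive - Y)"
proof -
  obtain M where M: "M > 0"
    "\<forall>x \<in> carrier G. \<forall>y \<in> carrier G. k x \<ge> M \<longrightarrow> k y \<ge> M \<longrightarrow> (x \<in> Y \<longleftrightarrow> y \<in> Y)"
    "\<forall>x \<in> carrier G. \<forall>y \<in> carrier G. k x \<le> - M \<longrightarrow> k y \<le> - M \<longrightarrow> (x \<in> Y \<longleftrightarrow> y \<in> Y)"
    by (rule right_commensurated_eventually_constant[OF Y])
  let ?F = "{x \<in> carrier G. \<bar>k x\<bar> \<le> M}"
  obtain p where p: "p \<in> carrier G" "k p = M" using height_onto by blast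
  obtain q where q: "q \<in> carrier G" "k q = - M" using height_onto by blast
  have far: "x \<in> Y \<longleftrightarrow> p \<in> Y" if "x \<in> positive - ?F" for x
  proof -
    have "x \<in> carrier G" "k x \<ge> M" using that by (auto simp: positive_def)
    then show ?thesis using M(2) p by (metis order_refl)
  qed
  show "finite (Y \<inter> positive) \<or> finite (positive - Y)"
  proof (cases "p \<in> Y")
    case True
    then have "positive - Y \<subseteq> ?F" using far by blast
    then show ?thesis using finite_heights finite_subset by blast
  next
    case False
    then have "Y \<inter> positive \<subseteq> ?F" using far by blast
    then show ?thesis using finite_heights finite_subset by blast
  qed
  have far: "x \<in> Y \<longleftrightarrow> q \<in> Y" if "x \<in> nonpositive - ?F" for x
  proof -
    have "x \<in> carrier G" "k x \<le> - M" using that by (auto simp: nonpositive_def)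
    then show ?thesis using M(3) q by (metis order_refl)
  qed
  show "finite (Y \<inter> nonpositive) \<or> finite (nonpositive - Y)"
  proof (cases "q \<in> Y")
    case True
    then have "nonpositive - Y \<subseteq> ?F" using far by blast
    then show ?thesis using finite_heights finite_subset by blast
  next
    case False
    then have "Y \<inter> nonpositive \<subseteq> ?F" using far by blast
    then show ?thesis using finite_heights finite_subset by blast
  qed
qed

lemma right_commensurated_translate:
  assumes Y: "right_commensurated Y" and g: "g \<in> carrier G"
  shows "right_commensurated (g <# Y)"
proof -
  have Yc: "Y \<subseteq> carrier G" using Y by (simp add: right_commensurated_def)
  have "finite (right_jumps (g <# Y) h)" if h: "h \<in> carrier G" for h
  proof -
    have "right_jumps (g <# Y) h \<subseteq> (\<lambda>x. g \<otimes> x) ` right_jumps Y h"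
    proof
      fix x assume x: "x \<in> right_jumps (g <# Y) h"
      then have xc: "x \<in> carrier G" by (simp add: right_jumps_def)
      have "inv g \<otimes> x \<in> right_jumps Y h"
        using x xc h g Yc by (simp add: right_jumps_def l_coset_mem_iff m_assoc)
      moreover have "x = g \<otimes> (inv g \<otimes> x)" using xc g by (simp flip: m_assoc)
      ultimately show "x \<in> (\<lambda>x. g \<otimes> x) ` right_jumps Y h" by blast
    qed
    moreover have "finite (right_jumps Y h)" using Y h by (simp add: right_commensurated_def)
    ultimately show ?thesis by (meson finite_imageI finite_subset)
  qed
  then show ?thesis using l_coset_carrier[OF Yc g] by (simp add: right_commensurated_def)
qed

text \<open>
  A left translate of the positive half is again commensurated on the right, so up to a finite set it
  is a union of halves. Being infinite with infinite complement, it is one of the two.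
\<close>
lemma translate_positive_dichotomy:
  assumes g: "g \<in> carrier G"
  shows "almost_eq (g <# positive) positive \<or> almost_eq (g <# positive) (carrier G - positive)"
proof -
  let ?Y = "g <# positive"
  have Pc: "positive \<subseteq> carrier G" by (auto simp: positive_def)
  have Yc: "?Y \<subseteq> carrier G" by (rule l_coset_carrier[OF Pc g])
  have inj: "inj_on (\<lambda>x. g \<otimes> x) (carrier G)" using g by (auto simp: inj_on_def)
  have "infinite ?Y"
    unfolding l_coset_eq_image using infinite_halves(1) inj_on_subset[OF inj Pc] by (simp add: finite_image_iff)
  moreover have "infinite (carrier G - ?Y)"
  proof -
    have "carrier G - ?Y = g <# nonpositive"
      unfolding nonpositive_eq by (rule l_coset_compl[OF Pc g, symmetric])
    moreover have "inj_on (\<lambda>x. g \<otimes> x) nonpositive"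
      by (rule inj_on_subset[OF inj]) (auto simp: nonpositive_def)
    ultimately show ?thesis
      unfolding l_coset_eq_image using infinite_halves(2) by (simp add: finite_image_iff)
  qed
  moreover have "?Y = (?Y \<inter> positive) \<union> (?Y \<inter> nonpositive)"
    "carrier G - ?Y = (positive - ?Y) \<union> (nonpositive - ?Y)"
    using Yc by (auto simp: nonpositive_eq positive_def)
  ultimately have "\<not> (finite (?Y \<inter> positive) \<and> finite (?Y \<inter> nonpositive))"
    "\<not> (finite (positive - ?Y) \<and> finite (nonpositive - ?Y))"
    by (metis finite_Un)+
  then have "finite (positive - ?Y) \<and> finite (?Y \<inter> nonpositive) \<or>
      finite (nonpositive - ?Y) \<and> finite (?Y \<inter> positive)"
    using right_commensurated_halves[OF right_commensurated_translate[OF right_commensurated_positive g]]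
    by blast
  moreover have "?Y - positive = ?Y \<inter> nonpositive" "?Y - (carrier G - positive) = ?Y \<inter> positive"
    using Yc by (auto simp: nonpositive_eq)
  ultimately show ?thesis
    by (auto simp: almost_eq_def nonpositive_eq)
qed

end

section \<open>Bi-ends as prime ideals\<close>

text \<open>
  The conditions say that non-membership in \<open>J\<close> is a homomorphism onto the field with two elements.
\<close>
lemma primeideal_set_ring_iff:
  assumes "cring (set_ring U \<A>)"
  shows "primeideal J (set_ring U \<A>) \<longleftrightarrow> J \<subseteq> \<A> \<and> U \<notin> J \<and>
    (\<forall>X\<in>\<A>. \<forall>Y\<in>\<A>. (X \<inter> Y \<in> J \<longleftrightarrow> X \<in> J \<or> Y \<in> J) \<and>
      (sym_diff X Y \<in> J \<longleftrightarrow> (X \<in> J \<longleftrightarrow> Y \<in> J)))" (is "?L \<longleftrightarrow> ?R")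
proof -
  interpret R: cring "set_ring U \<A>" by fact
  have U: "U \<in> \<A>" using R.one_closed by simp
  have sub: "X \<subseteq> U" if "X \<in> \<A>" for X using R.l_one[of X] that by auto
  have sd: "sym_diff X Y \<in> \<A>" if "X \<in> \<A>" "Y \<in> \<A>" for X Y
    using R.a_closed[of X Y] that by simp
  show ?thesis
  proof
    assume ?L
    then interpret J: primeideal J "set_ring U \<A>" .
    have add: "sym_diff X Y \<in> J" if "X \<in> J" "Y \<in> J" for X Y
      using J.a_closed[OF that] by simp
    have JA: "J \<subseteq> \<A>" using J.a_subset by simp
    have UJ: "U \<notin> J" using J.one_imp_carrier J.I_notcarr by auto
    have compl: "sym_diff U X \<in> J" if "X \<in> \<A>" "X \<notin> J" for X
    proof -
      have "X \<inter> sym_diff U X = {}" using sub[OF that(1)] by blast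
      also have "{} \<in> J" using J.zero_closed by simp
      finally have "X \<inter> sym_diff U X \<in> J" .
      then show ?thesis using J.I_prime[of X "sym_diff U X"] that sd[OF U that(1)] by simp
    qed
    have "X \<inter> Y \<in> J \<longleftrightarrow> X \<in> J \<or> Y \<in> J" if "X \<in> \<A>" "Y \<in> \<A>" for X Y
      using J.I_prime[of X Y] J.I_l_closed[of Y X] J.I_r_closed[of X Y] that by auto
    moreover have "sym_diff X Y \<in> J \<longleftrightarrow> (X \<in> J \<longleftrightarrow> Y \<in> J)" if XY: "X \<in> \<A>" "Y \<in> \<A>" for X Y
    proof
      assume *: "sym_diff X Y \<in> J"
      have "sym_diff X (sym_diff X Y) = Y" "sym_diff Y (sym_diff X Y) = X" by blast+
      then show "X \<in> J \<longleftrightarrow> Y \<in> J" using add[OF _ *] by metis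
    next
      assume eq: "X \<in> J \<longleftrightarrow> Y \<in> J"
      have "sym_diff (sym_diff U X) (sym_diff U Y) = sym_diff X Y" using sub XY by blast
      then show "sym_diff X Y \<in> J"
        using eq add[of X Y] add[of "sym_diff U X" "sym_diff U Y"] compl XY by metis
    qed
    ultimately show ?R using JA UJ by blast
  next
    assume r: ?R
    have a_inv: "\<ominus>\<^bsub>set_ring U \<A>\<^esub> X = X" if "X \<in> \<A>" for X
      using that by (intro R.minus_equality) auto
    show ?L
    proof (rule primeidealI)
      show "ideal J (set_ring U \<A>)"
      proof (rule idealI[OF R.ring_axioms])
        show "subgroup J (add_monoid (set_ring U \<A>))"
        proof (rule group.subgroupI[OF R.a_group])
          have "sym_diff U U \<in> J" using r U by blast
          then show "J \<noteq> {}" by blast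
        next
          fix X assume X: "X \<in> J"
          then have "inv\<^bsub>add_monoid (set_ring U \<A>)\<^esub> X = X"
            using r a_inv[of X] by (auto simp: a_inv_def)
          with X show "inv\<^bsub>add_monoid (set_ring U \<A>)\<^esub> X \<in> J" by simp
        next
          fix X Y assume "X \<in> J" "Y \<in> J"
          then have "sym_diff X Y \<in> J" using r by blast
          then show "X \<otimes>\<^bsub>add_monoid (set_ring U \<A>)\<^esub> Y \<in> J" by simp
        qed (use r in auto)
      qed (use r in auto)
    qed (use r U R.is_cring in auto)
  qed
qed

lemma (in cring) bij_betw_primeideals_quotient:
  assumes I: "ideal I R"
  shows "bij_betw (\<lambda>P. {x \<in> carrier R. I +> x \<in> P})
    {P. primeideal P (R Quot I)} {J. primeideal J R \<and> I \<subseteq> J}"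
proof (rule bij_betw_byWitness[where f' = "\<lambda>J. (+>) I ` J"])
  interpret I: ideal I R by fact
  have carr: "carrier (R Quot I) = (+>) I ` carrier R"
    by (auto simp: FactRing_def A_RCOSETS_def')
  have preimage: "{x \<in> carrier R. I +> x \<in> (+>) I ` J} = J" if "ideal J R" "I \<subseteq> J" for J
  proof -
    interpret J: ideal J R by fact
    have "x \<in> J" if x: "x \<in> carrier R" "I +> x = I +> j" "j \<in> J" for x j
    proof -
      have "x \<in> I +> j" using I.a_rcos_self[OF x(1)] x(2) by simp
      then obtain i where "i \<in> I" "x = i \<oplus> j" by (auto simp: a_r_coset_def')
      then show ?thesis using x(3) \<open>I \<subseteq> J\<close> J.a_closed by blast
    qed
    then show ?thesis using J.a_subset by blast
  qed
  show "\<forall>P\<in>{P. primeideal P (R Quot I)}. (+>) I ` {x \<in> carrier R. I +> x \<in> P} = P"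
  proof
    fix P assume "P \<in> {P. primeideal P (R Quot I)}"
    then interpret P: primeideal P "R Quot I" by simp
    show "(+>) I ` {x \<in> carrier R. I +> x \<in> P} = P" using P.a_subset carr by auto
  qed
  show "\<forall>J\<in>{J. primeideal J R \<and> I \<subseteq> J}. {x \<in> carrier R. I +> x \<in> (+>) I ` J} = J"
    using preimage primeideal.axioms(1) by blast
  show "(\<lambda>P. {x \<in> carrier R. I +> x \<in> P}) ` {P. primeideal P (R Quot I)} \<subseteq> {J. primeideal J R \<and> I \<subseteq> J}"
  proof clarify
    fix P assume P: "primeideal P (R Quot I)"
    interpret P: primeideal P "R Quot I" by fact
    have "primeideal {x \<in> carrier R. I +> x \<in> P} R"
      by (rule ring_hom_ring.primeideal_vimage[OF I.rcos_ring_hom_ring is_cring P])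
    moreover have "I +> x \<in> P" if "x \<in> I" for x
      using additive_subgroup.zero_closed[OF P.additive_subgroup_axioms] I.a_rcos_const[OF that] by (simp add: FactRing_def)
    ultimately show "primeideal {x \<in> carrier R. I +> x \<in> P} R \<and> I \<subseteq> {x \<in> carrier R. I +> x \<in> P}"
      using I.a_subset by blast
  qed
  show "(`) ((+>) I) ` {J. primeideal J R \<and> I \<subseteq> J} \<subseteq> {P. primeideal P (R Quot I)}"
  proof clarify
    fix J assume J: "primeideal J R" "I \<subseteq> J"
    interpret J: primeideal J R by fact
    have eq: "{x \<in> carrier R. I +> x \<in> (+>) I ` J} = J" by (rule preimage[OF J.is_ideal J(2)])
    have mem: "I +> x \<in> (+>) I ` J \<longleftrightarrow> x \<in> J" if "x \<in> carrier R" for x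
      using that eqset_imp_iff[OF eq, of x] by simp
    show "primeideal ((+>) I ` J) (R Quot I)"
    proof (rule primeidealI)
      show "ideal ((+>) I ` J) (R Quot I)" by (rule ring_ideal_imp_quot_ideal[OF I J.is_ideal])
      show "cring (R Quot I)" by (rule I.quotient_is_cring[OF is_cring])
      show "carrier (R Quot I) \<noteq> (+>) I ` J"
      proof
        assume e: "carrier (R Quot I) = (+>) I ` J"
        have "x \<in> J" if x: "x \<in> carrier R" for x
        proof -
          have "I +> x \<in> (+>) I ` J" using x unfolding e[symmetric] carr by (rule imageI)
          then show ?thesis using mem[OF x] by simp
        qed
        then show False using J.I_notcarr J.a_subset by blast
      qed
      fix a b assume ab: "a \<in> carrier (R Quot I)" "b \<in> carrier (R Quot I)"
        and in_J: "a \<otimes>\<^bsub>R Quot I\<^esub> b \<in> (+>) I ` J"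
      obtain x where x: "x \<in> carrier R" "a = I +> x" using ab(1) unfolding carr by blast
      obtain y where y: "y \<in> carrier R" "b = I +> y" using ab(2) unfolding carr by blast
      have "I +> (x \<otimes> y) \<in> (+>) I ` J"
        using in_J x y I.rcoset_mult_add by (simp add: FactRing_def)
      then have "x \<otimes> y \<in> J" using mem[of "x \<otimes> y"] x y by simp
      then have "x \<in> J \<or> y \<in> J" using J.I_prime x y by blast
      then show "a \<in> (+>) I ` J \<or> b \<in> (+>) I ` J" using x y by blast
    qed
  qed
qed

text \<open>
  The points of the Stone dual are prime ideals of a quotient ring, that is, sets of cosets. It is
  easier to work with their preimages in the algebra of bi-commensurated sets itself.
\<close>
definition biend_ideals :: "('a, 'b) monoid_scheme \<Rightarrow> 'a set set set"
  where "biend_ideals G = {J. primeideal J (bicomm_algebra G) \<and> {X. X \<subseteq> carrier G \<and> finite X} \<subseteq> J}"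

definition mod_finite_class :: "('a, 'b) monoid_scheme \<Rightarrow> 'a set \<Rightarrow> 'a set set"
  where "mod_finite_class G X = {X. X \<subseteq> carrier G \<and> finite X} +>\<^bsub>bicomm_algebra G\<^esub> X"

lemma carrier_bicomm_algebra: "carrier (bicomm_algebra G) = {X. bicommensurated G X}"
  by (simp add: bicomm_algebra_def)

lemma carrier_bicomm_algebra_mod_finite:
  "carrier (bicomm_algebra_mod_finite G) = mod_finite_class G ` {X. bicommensurated G X}"
  by (auto simp: bicomm_algebra_mod_finite_def FactRing_def A_RCOSETS_def' mod_finite_class_def
      carrier_bicomm_algebra)

context group
begin

lemma biends_eq: "biends G = {P. primeideal P (bicomm_algebra_mod_finite G)}"
  unfolding biend_space_def bicomm_algebra_mod_finite_def
  by (rule topspace_stone_dual[OF ideal.quotient_is_ring[OF ideal_finite_subsets[OF group_axioms]]])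

lemma bij_betw_biends:
  "bij_betw (\<lambda>P. {X. bicommensurated G X \<and> mod_finite_class G X \<in> P}) (biends G) (biend_ideals G)"
  using cring.bij_betw_primeideals_quotient[OF cring_bicomm_algebra[OF group_axioms]
      ideal_finite_subsets[OF group_axioms]]
  unfolding biends_eq biend_ideals_def bicomm_algebra_mod_finite_def mod_finite_class_def
    carrier_bicomm_algebra by simp

lemma biend_ideals_iff:
  "J \<in> biend_ideals G \<longleftrightarrow> (\<forall>X\<in>J. bicommensurated G X) \<and> carrier G \<notin> J \<and>
    (\<forall>X. X \<subseteq> carrier G \<longrightarrow> finite X \<longrightarrow> X \<in> J) \<and>
    (\<forall>X Y. bicommensurated G X \<longrightarrow> bicommensurated G Y \<longrightarrow>
      (X \<inter> Y \<in> J \<longleftrightarrow> X \<in> J \<or> Y \<in> J) \<and> (sym_diff X Y \<in> J \<longleftrightarrow> (X \<in> J \<longleftrightarrow> Y \<in> J)))"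
proof -
  have "primeideal J (bicomm_algebra G) \<longleftrightarrow> J \<subseteq> {X. bicommensurated G X} \<and> carrier G \<notin> J \<and>
    (\<forall>X\<in>{X. bicommensurated G X}. \<forall>Y\<in>{X. bicommensurated G X}. (X \<inter> Y \<in> J \<longleftrightarrow> X \<in> J \<or> Y \<in> J) \<and>
      (sym_diff X Y \<in> J \<longleftrightarrow> (X \<in> J \<longleftrightarrow> Y \<in> J)))"
    unfolding bicomm_algebra_def
    by (rule primeideal_set_ring_iff[OF cring_bicomm_algebra[OF group_axioms, unfolded bicomm_algebra_def]])
  then show ?thesis unfolding biend_ideals_def mem_Collect_eq by blast
qed

text \<open>
  An atom of the Boolean algebra of bi-commensurated sets modulo finite sets.
\<close>
definition bicomm_atom :: "'a set \<Rightarrow> bool"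
  where "bicomm_atom A \<longleftrightarrow> bicommensurated G A \<and> infinite A \<and>
    (\<forall>Y. bicommensurated G Y \<longrightarrow> finite (Y \<inter> A) \<or> finite (A - Y))"

lemma bicomm_atom_ideal:
  assumes A: "bicomm_atom A"
  shows "{Y. bicommensurated G Y \<and> finite (Y \<inter> A)} \<in> biend_ideals G"
  unfolding biend_ideals_iff
proof (intro conjI allI impI)
  have Ac: "bicommensurated G A" "infinite A" "A \<subseteq> carrier G"
    using A by (auto simp: bicomm_atom_def bicommensurated_def)
  have co: "finite (A - Y) \<longleftrightarrow> infinite (Y \<inter> A)" if "bicommensurated G Y" for Y
  proof -
    have "A = (A - Y) \<union> (Y \<inter> A)" by blast
    then have "\<not> (finite (A - Y) \<and> finite (Y \<inter> A))" using Ac(2) by (metis finite_UnI)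
    then show ?thesis using A that by (auto simp: bicomm_atom_def)
  qed
  show "carrier G \<notin> {Y. bicommensurated G Y \<and> finite (Y \<inter> A)}"
    using Ac by (simp add: Int_absorb1)
  fix X Y assume XY: "bicommensurated G X" "bicommensurated G Y"
  have i: "bicommensurated G (X \<inter> Y)" and d: "bicommensurated G (sym_diff X Y)"
    using bicommensurated_Int[OF group_axioms XY] bicommensurated_sym_diff[OF group_axioms XY] .
  have "infinite (X \<inter> Y \<inter> A) \<longleftrightarrow> infinite (X \<inter> A) \<and> infinite (Y \<inter> A)"
  proof -
    have "A - X \<inter> Y = (A - X) \<union> (A - Y)" by blast
    then have "finite (A - X \<inter> Y) \<longleftrightarrow> finite (A - X) \<and> finite (A - Y)" by (metis finite_Un)
    then show ?thesis using co[OF i] co[OF XY(1)] co[OF XY(2)] by simp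
  qed
  then show "X \<inter> Y \<in> {Y. bicommensurated G Y \<and> finite (Y \<inter> A)} \<longleftrightarrow>
      X \<in> {Y. bicommensurated G Y \<and> finite (Y \<inter> A)} \<or> Y \<in> {Y. bicommensurated G Y \<and> finite (Y \<inter> A)}"
    using i XY by blast
  have "finite (sym_diff X Y \<inter> A) \<longleftrightarrow> (finite (X \<inter> A) \<longleftrightarrow> finite (Y \<inter> A))"
  proof
    assume f: "finite (sym_diff X Y \<inter> A)"
    have "X \<inter> A \<subseteq> (sym_diff X Y \<inter> A) \<union> (Y \<inter> A)" "Y \<inter> A \<subseteq> (sym_diff X Y \<inter> A) \<union> (X \<inter> A)" by blast+
    then show "finite (X \<inter> A) \<longleftrightarrow> finite (Y \<inter> A)" using f by (meson finite_UnI finite_subset)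
  next
    assume eq: "finite (X \<inter> A) \<longleftrightarrow> finite (Y \<inter> A)"
    have "sym_diff X Y \<inter> A \<subseteq> (X \<inter> A) \<union> (Y \<inter> A)" "sym_diff X Y \<inter> A \<subseteq> (A - X) \<union> (A - Y)" by blast+
    then show "finite (sym_diff X Y \<inter> A)"
      using eq co[OF XY(1)] co[OF XY(2)] by (meson finite_UnI finite_subset)
  qed
  then show "sym_diff X Y \<in> {Y. bicommensurated G Y \<and> finite (Y \<inter> A)} \<longleftrightarrow>
      (X \<in> {Y. bicommensurated G Y \<and> finite (Y \<inter> A)} \<longleftrightarrow> Y \<in> {Y. bicommensurated G Y \<and> finite (Y \<inter> A)})"
    using d XY by blast
qed (auto intro: bicommensurated_finite)

lemma bicomm_atom_ideal_unique:
  assumes A: "bicomm_atom A" and J: "J \<in> biend_ideals G" and AJ: "A \<notin> J"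
  shows "J = {Y. bicommensurated G Y \<and> finite (Y \<inter> A)}"
proof -
  have Ac: "bicommensurated G A" "A \<subseteq> carrier G"
    using A by (auto simp: bicomm_atom_def bicommensurated_def)
  have bi: "\<And>X. X \<in> J \<Longrightarrow> bicommensurated G X"
    and fin: "\<And>X. X \<subseteq> carrier G \<Longrightarrow> finite X \<Longrightarrow> X \<in> J"
    and int: "\<And>X Y. bicommensurated G X \<Longrightarrow> bicommensurated G Y \<Longrightarrow> X \<inter> Y \<in> J \<longleftrightarrow> X \<in> J \<or> Y \<in> J"
    and sd: "\<And>X Y. bicommensurated G X \<Longrightarrow> bicommensurated G Y \<Longrightarrow> sym_diff X Y \<in> J \<longleftrightarrow> (X \<in> J \<longleftrightarrow> Y \<in> J)"
    using J unfolding biend_ideals_iff by blast+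
  have "Y \<in> J \<longleftrightarrow> finite (Y \<inter> A)" if Y: "bicommensurated G Y" for Y
  proof
    assume YJ: "Y \<in> J"
    show "finite (Y \<inter> A)"
    proof (rule ccontr)
      assume "infinite (Y \<inter> A)"
      then have "finite (A - Y)" using A Y by (auto simp: bicomm_atom_def)
      then have 1: "A - Y \<in> J" using Ac(2) by (intro fin) auto
      have 2: "Y \<inter> A \<in> J" using int[OF Y Ac(1)] YJ by blast
      have "sym_diff (A - Y) (Y \<inter> A) \<in> J" using sd[OF bi[OF 1] bi[OF 2]] 1 2 by blast
      moreover have "sym_diff (A - Y) (Y \<inter> A) = A" by blast
      ultimately show False using AJ by simp
    qed
  next
    assume "finite (Y \<inter> A)"
    then have "Y \<inter> A \<in> J" using Ac(2) by (intro fin) auto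
    then show "Y \<in> J" using int[OF Y Ac(1)] AJ by blast
  qed
  then show ?thesis using bi by blast
qed

lemma card_biends_eq: "card (biends G) = card (biend_ideals G)"
  by (rule bij_betw_same_card[OF bij_betw_biends])

lemma biends_finite_group:
  assumes "finite (carrier G)"
  shows "biends G = {}"
proof -
  have "biend_ideals G = {}"
  proof (rule equals0I)
    fix J assume "J \<in> biend_ideals G"
    then have "carrier G \<notin> J" "finite (carrier G) \<longrightarrow> carrier G \<in> J"
      unfolding biend_ideals_iff by blast+
    with assms show False by blast
  qed
  then show ?thesis using bij_betw_biends bij_betw_empty2 by metis
qed

lemma card_biends_1:
  assumes "infinite (carrier G)"
    and "\<And>Y. bicommensurated G Y \<Longrightarrow> finite Y \<or> finite (carrier G - Y)"
  shows "card (biends G) = 1"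
proof -
  have "bicomm_atom (carrier G)"
    using assms bicommensurated_carrier[OF group_axioms]
    by (auto simp: bicomm_atom_def)
  then have "biend_ideals G = {{Y. bicommensurated G Y \<and> finite (Y \<inter> carrier G)}}"
    using bicomm_atom_ideal bicomm_atom_ideal_unique biend_ideals_iff by blast
  then show ?thesis by (simp add: card_biends_eq)
qed

text \<open>
  A prime ideal cannot contain both atoms, since their union is everything; and it is determined by
  any atom that it misses.
\<close>
lemma card_biends_2:
  assumes A: "bicomm_atom A" and B: "bicomm_atom B" and AB: "A \<inter> B = {}" "A \<union> B = carrier G"
  shows "card (biends G) = 2"
proof -
  let ?J = "\<lambda>A. {Y. bicommensurated G Y \<and> finite (Y \<inter> A)}"
  have bi: "bicommensurated G A" "bicommensurated G B" "infinite A"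
    using A B by (auto simp: bicomm_atom_def)
  have "J = ?J A \<or> J = ?J B" if J: "J \<in> biend_ideals G" for J
  proof -
    have "sym_diff A B = carrier G" using AB by blast
    then have "\<not> (A \<in> J \<and> B \<in> J)" using J bi unfolding biend_ideals_iff by metis
    then show ?thesis using bicomm_atom_ideal_unique[OF A J] bicomm_atom_ideal_unique[OF B J] by blast
  qed
  then have "biend_ideals G = {?J A, ?J B}"
    using bicomm_atom_ideal[OF A] bicomm_atom_ideal[OF B] by blast
  moreover have "A \<in> ?J B" "A \<notin> ?J A" using bi AB by auto
  then have "?J A \<noteq> ?J B" by blast
  ultimately show ?thesis by (simp add: card_biends_eq)
qed

end

section \<open>Infinite virtually cyclic groups\<close>

lemma finite_byD:
  assumes "group G" "group Q" "finite_by G Q"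
  obtains h where "h \<in> hom G Q" "h ` carrier G = carrier Q" "finite {g \<in> carrier G. h g = \<one>\<^bsub>Q\<^esub>}"
proof -
  obtain N where N: "N \<lhd> G" "finite N" "G Mod N \<cong> Q" using assms(3) by (auto simp: finite_by_def)
  interpret N: normal N G by fact
  interpret Q: group Q by fact
  obtain p where p: "p \<in> iso (G Mod N) Q" using N(3) by (auto simp: is_iso_def)
  have pbij: "bij_betw p (carrier (G Mod N)) (carrier Q)" and phom: "p \<in> hom (G Mod N) Q"
    using p by (auto simp: iso_def)
  let ?h = "p \<circ> (\<lambda>a. N #>\<^bsub>G\<^esub> a)"
  have carr: "carrier (G Mod N) = (\<lambda>a. N #>\<^bsub>G\<^esub> a) ` carrier G"
    by (auto simp: FactGroup_def RCOSETS_def)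
  have h: "?h \<in> hom G Q" by (rule hom_compose[OF N.r_coset_hom_Mod phom])
  moreover have "?h ` carrier G = carrier Q"
    using pbij unfolding bij_betw_def carr image_comp by blast
  moreover have "{g \<in> carrier G. ?h g = \<one>\<^bsub>Q\<^esub>} \<subseteq> N"
  proof
    fix g assume "g \<in> {g \<in> carrier G. ?h g = \<one>\<^bsub>Q\<^esub>}"
    then have g: "g \<in> carrier G" "p (N #>\<^bsub>G\<^esub> g) = \<one>\<^bsub>Q\<^esub>" by auto
    have "p (N #>\<^bsub>G\<^esub> \<one>\<^bsub>G\<^esub>) = \<one>\<^bsub>Q\<^esub>"
      using hom_one[OF h assms(1) assms(2)] by simp
    then have "N #>\<^bsub>G\<^esub> g = N #>\<^bsub>G\<^esub> \<one>\<^bsub>G\<^esub>"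
      using g pbij unfolding bij_betw_def carr by (intro inj_onD[of p]) auto
    then have "N #>\<^bsub>G\<^esub> g = N" using N.subset by (simp add: N.coset_mult_one)
    then show "g \<in> N" using g(1) N.coset_join1 N.subgroup_axioms by blast
  qed
  then have "finite {g \<in> carrier G. ?h g = \<one>\<^bsub>Q\<^esub>}" using N(2) finite_subset by blast
  ultimately show thesis by (rule that)
qed

context group
begin

lemma height_function_of_hom:
  assumes h: "h \<in> hom G integer_group" "h ` carrier G = UNIV" "finite {g \<in> carrier G. h g = 0}"
  obtains c where "height_function G c h"
proof -
  have add: "h (x \<otimes> y) = h x + h y" if "x \<in> carrier G" "y \<in> carrier G" for x y
    using hom_mult[OF h(1) that] by simp
  obtain c where c: "c \<in> carrier G" "h c = 1" using h(2) by (metis UNIV_I imageE)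
  have "height_function G c h"
  proof unfold_locales
    fix g assume "g \<in> carrier G"
    then show "\<exists>M. \<forall>x\<in>carrier G. \<bar>h (x \<otimes> g) - h x\<bar> \<le> M"
      by (intro exI[of _ "\<bar>h g\<bar>"]) (simp add: add)
  qed (use c h add in simp_all)
  then show thesis by (rule that)
qed

end

context height_function
begin

lemma infinite_carrier: "infinite (carrier G)"
  using infinite_halves(1) finite_subset[of positive "carrier G"] by (auto simp: positive_def)

lemma pow_reaches_level_0:
  assumes "x \<in> carrier G"
  obtains r where "r \<in> carrier G" "k r = 0" "x = c [^] (k x) \<otimes> r"
proof
  show "c [^] (- k x) \<otimes> x \<in> carrier G" using assms c_closed by simp
  show "k (c [^] (- k x) \<otimes> x) = 0" using height_pow[OF assms, of "- k x"] by simp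
  show "x = c [^] (k x) \<otimes> (c [^] (- k x) \<otimes> x)"
    using assms c_closed by (simp add: int_pow_neg flip: m_assoc)
qed

lemma pow_in_generate: "c [^] (n::int) \<in> generate G {c}"
  using generate_pow[OF c_closed] by blast

lemma finitely_generated: "finitely_generated_group G"
proof -
  let ?S = "insert c {x \<in> carrier G. k x = 0}"
  have S: "?S \<subseteq> carrier G" "finite ?S" using c_closed finite_level_0 by auto
  have "x \<in> generate G ?S" if x: "x \<in> carrier G" for x
  proof -
    obtain r where r: "r \<in> carrier G" "k r = 0" "x = c [^] (k x) \<otimes> r"
      by (rule pow_reaches_level_0[OF x])
    have "generate G {c} \<subseteq> generate G ?S" by (rule mono_generate) simp
    then have "c [^] (k x) \<in> generate G ?S" using pow_in_generate by blast
    moreover have "r \<in> generate G ?S" using r by (intro generate.incl) simp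
    ultimately show ?thesis using r(3) generate.eng by metis
  qed
  then have "generate G ?S = carrier G" using generate_incl[OF S(1)] by blast
  then show ?thesis using S unfolding finitely_generated_group_def by blast
qed

lemma not_locally_finite: "\<not> locally_finite_group G"
proof
  assume "locally_finite_group G"
  then have fin: "finite (generate G {c})" using c_closed by (simp add: locally_finite_group_def)
  have "n \<in> k ` generate G {c}" for n
  proof -
    have "k (c [^] (n - k \<one>) \<otimes> \<one>) = n" using height_pow[of \<one> "n - k \<one>"] by simp
    then have "k (c [^] (n - k \<one>)) = n" using c_closed by simp
    then show ?thesis using pow_in_generate by (metis imageI)
  qed
  then have "k ` generate G {c} = UNIV" by blast
  then have "finite (UNIV :: int set)" using fin by (metis finite_imageI)
  then show False by simp
qed

lemma virtually_cyclic: "virtually_cyclic_group G"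
proof -
  let ?H = "generate G {c}"
  have H: "subgroup ?H G" using generate_is_subgroup[of "{c}"] c_closed by simp
  have "rcosets ?H \<subseteq> (\<lambda>r. ?H #> r) ` {x \<in> carrier G. k x = 0}"
  proof
    fix C assume "C \<in> rcosets ?H"
    then obtain x where x: "x \<in> carrier G" "C = ?H #> x" by (auto simp: RCOSETS_def)
    obtain r where r: "r \<in> carrier G" "k r = 0" "x = c [^] (k x) \<otimes> r"
      by (rule pow_reaches_level_0[OF x(1)])
    have "x \<in> ?H #> r" using r(3) pow_in_generate unfolding r_coset_def by blast
    then have "?H #> r = C" unfolding x(2) using r(1) H by (intro repr_independence)
    then show "C \<in> (\<lambda>r. ?H #> r) ` {x \<in> carrier G. k x = 0}" using r by blast
  qed
  then have "finite (rcosets ?H)" using finite_level_0 by (meson finite_imageI finite_subset)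
  moreover have "subgroup_generated G ?H = subgroup_generated G {c}"
    using subgroup.carrier_subgroup_generated_subgroup[OF H] c_closed
    by (simp add: subgroup_generated_def)
  then have "cyclic_group (subgroup_generated G ?H)" using cyclic_group_generated[of c] by simp
  ultimately show ?thesis using H unfolding virtually_cyclic_group_def by blast
qed

text \<open>
  The positive half is commensurated on the right and its left translates agree with it or with its
  complement up to finite sets, so its displacement decides between the two cases.
\<close>
lemma finite_by_integer_or_dihedral:
  "finite_by G integer_group \<or> finite_by G infinite_dihedral_group"
proof -
  obtain S where S: "S \<subseteq> carrier G" "finite S" "generate G S = carrier G"
    using finitely_generated by (auto simp: finitely_generated_group_def)
  have inf: "infinite (carrier G - positive)" using infinite_halves(2) by (simp add: nonpositive_eq)
  have dich: "\<forall>g \<in> carrier G. almost_eq (g <# positive) positive \<or>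
      almost_eq (g <# positive) (carrier G - positive)"
    using translate_positive_dichotomy by blast
  show ?thesis
  proof (cases "almost_stabilizer positive = carrier G")
    case True
    then show ?thesis
      using finite_by_integer_if_stabilized[OF S right_commensurated_positive infinite_halves(1) inf]
      by blast
  next
    case False
    then obtain s where "s \<in> carrier G" "s \<notin> almost_stabilizer positive"
      unfolding almost_stabilizer_def by blast
    then show ?thesis
      using finite_by_dihedral_if_flipped[OF S right_commensurated_positive infinite_halves(1) inf dich]
      by blast
  qed
qed

end

context group
begin

lemma height_function_if_finite_by_integer:
  assumes "finite_by G integer_group"
  obtains c k where "height_function G c k" "\<forall>x\<in>carrier G. \<forall>y\<in>carrier G. k (x \<otimes> y) = k x + k y"
proof -
  obtain h where h: "h \<in> hom G integer_group" "h ` carrier G = carrier integer_group"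
    "finite {g \<in> carrier G. h g = \<one>\<^bsub>integer_group\<^esub>}"
    by (rule finite_byD[OF group_axioms group_integer_group assms])
  obtain c where "height_function G c h"
    using height_function_of_hom[of h] h by auto
  moreover have "h (x \<otimes> y) = h x + h y" if "x \<in> carrier G" "y \<in> carrier G" for x y
    using hom_mult[OF h(1) that] by simp
  ultimately show thesis using that by blast
qed

text \<open>
  Since the height is a homomorphism here, left translation by \<open>g\<close> also changes heights by a bounded
  amount, so that the halves are commensurated on both sides. They are atoms because a set that is
  commensurated on the right contains almost all or almost none of each half.
\<close>
lemma card_biends_finite_by_integer:
  assumes "finite_by G integer_group"
  shows "card (biends G) = 2"
proof -
  obtain c k where hf: "height_function G c k"
    and add: "\<forall>x\<in>carrier G. \<forall>y\<in>carrier G. k (x \<otimes> y) = k x + k y"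
    by (rule height_function_if_finite_by_integer[OF assms])
  interpret height_function G c k by fact
  have rc: "right_commensurated Y" if "bicommensurated G Y" for Y
    using that by (simp add: bicommensurated_iff_jumps right_commensurated_def)
  have P: "bicommensurated G positive"
    unfolding bicommensurated_iff_jumps
  proof (intro conjI ballI)
    fix g assume g: "g \<in> carrier G"
    have "left_jumps positive g \<subseteq> {x \<in> carrier G. \<bar>k x\<bar> \<le> \<bar>k g\<bar>}"
    proof
      fix x assume x: "x \<in> left_jumps positive g"
      then have xc: "x \<in> carrier G" by (simp add: left_jumps_def)
      have "k (g \<otimes> x) = k g + k x" using add g xc by blast
      then have "(k x > 0) \<noteq> (k g + k x > 0)"
        using x xc g by (simp add: left_jumps_def positive_def)
      then show "x \<in> {x \<in> carrier G. \<bar>k x\<bar> \<le> \<bar>k g\<bar>}" using xc by auto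
    qed
    then show "finite (left_jumps positive g)" using finite_heights finite_subset by blast
  qed (use right_commensurated_positive in \<open>auto simp: right_commensurated_def\<close>)
  have N: "bicommensurated G nonpositive"
    unfolding nonpositive_eq by (rule bicommensurated_compl[OF P])
  show ?thesis
  proof (rule card_biends_2)
    show "bicomm_atom positive" "bicomm_atom nonpositive"
      using P N infinite_halves right_commensurated_halves[OF rc] unfolding bicomm_atom_def by blast+
  qed (auto simp: positive_def nonpositive_def)
qed

text \<open>
  Write \<open>x = c\<^sup>nr\<close> with \<open>r\<close> the chosen representative of the right coset of \<open>x\<close>, and let \<open>k(x) = n\<close>.
  Then \<open>k(xg) = k(x) + k(rg)\<close>, where \<open>r\<close> runs through a finite set.
\<close>
lemma height_function_if_virtually_cyclic:
  assumes vc: "virtually_cyclic_group G" and inf: "infinite (carrier G)"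
  obtains c k where "height_function G c k"
proof -
  obtain H where H: "subgroup H G" "finite (rcosets H)" and cyc: "cyclic_group (subgroup_generated G H)"
    using vc by (auto simp: virtually_cyclic_group_def)
  interpret H: subgroup H G by fact
  obtain c where c: "c \<in> H" and Hc: "H = range (\<lambda>n::int. c [^] n)"
  proof -
    have "\<exists>x \<in> carrier (subgroup_generated G H). carrier (subgroup_generated G H) =
        range (\<lambda>n::int. x [^]\<^bsub>subgroup_generated G H\<^esub> n)"
      using cyc group.cyclic_group[OF group_subgroup_generated] by blast
    then obtain x where x: "x \<in> H" "H = range (\<lambda>n::int. x [^]\<^bsub>subgroup_generated G H\<^esub> n)" by auto
    have "x [^]\<^bsub>subgroup_generated G H\<^esub> n = x [^] n" for n :: int
      using int_pow_subgroup_generated[of x H n] x(1) by simp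
    then show thesis using that x by simp
  qed
  have cc: "c \<in> carrier G" by (rule H.mem_carrier[OF c])
  have "infinite H"
  proof
    assume "finite H"
    then have "finite C" if "C \<in> rcosets H" for C using that by (auto simp: RCOSETS_def r_coset_def)
    then have "finite (\<Union>(rcosets H))" using H(2) by blast
    then show False using inf rcosets_part_G[OF H(1)] by simp
  qed
  then have "infinite (carrier (subgroup_generated G {c}))"
    using Hc generate_pow[OF cc] cc by (simp add: carrier_subgroup_generated full_SetCompr_eq)
  then have inj: "m = n" if "c [^] m = c [^] n" for m n :: int
    using that infinite_cyclic_subgroup_int[OF cc] by blast
  define rep where "rep x = (SOME y. y \<in> H #> x)" for x
  have rep_mem: "rep x \<in> H #> x" if "x \<in> carrier G" for x
    unfolding rep_def by (rule someI[of _ x]) (rule rcos_self[OF that H(1)])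
  have rep_c: "rep x \<in> carrier G" if "x \<in> carrier G" for x
    using rep_mem[OF that] r_coset_subset_G[OF H.subset that] by blast
  have coset_rep: "H #> rep x = H #> x" if "x \<in> carrier G" for x
    using repr_independence[OF rep_mem[OF that] that H(1)] by simp
  have rep_eq: "rep x = rep y" if "H #> x = H #> y" for x y by (simp add: rep_def that)
  define k where "k x = (THE n::int. x = c [^] n \<otimes> rep x)" for x
  have k_unique: "k x = n" if x: "x \<in> carrier G" "x = c [^] n \<otimes> rep x" for x n
    unfolding k_def
  proof (rule the_equality, rule x(2))
    fix m :: int assume "x = c [^] m \<otimes> rep x"
    then have "c [^] m \<otimes> rep x = c [^] n \<otimes> rep x" using x(2) by simp
    then show "m = n" using inj[of m n] rep_c[OF x(1)] cc by simp
  qed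
  have k: "x = c [^] (k x) \<otimes> rep x" if x: "x \<in> carrier G" for x
  proof -
    have "x \<in> H #> rep x" using coset_rep[OF x] rcos_self[OF x H(1)] by simp
    then obtain n :: int where "x = c [^] n \<otimes> rep x" unfolding Hc r_coset_def by blast
    then show ?thesis using k_unique[OF x] by simp
  qed
  have rep_pow: "rep (c [^] n \<otimes> x) = rep x" if x: "x \<in> carrier G" for x and n :: int
  proof (rule rep_eq)
    have "c [^] n \<otimes> x \<in> H #> x" using Hc unfolding r_coset_def by blast
    then show "H #> (c [^] n \<otimes> x) = H #> x" using repr_independence[OF _ x H(1)] by simp
  qed
  have k_pow: "k (c [^] n \<otimes> x) = n + k x" if x: "x \<in> carrier G" for x and n :: int
  proof (rule k_unique)
    show "c [^] n \<otimes> x \<in> carrier G" using x cc by simp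
    have "c [^] n \<otimes> x = c [^] n \<otimes> (c [^] (k x) \<otimes> rep x)" using k[OF x] by simp
    then show "c [^] n \<otimes> x = c [^] (n + k x) \<otimes> rep (c [^] n \<otimes> x)"
      using x cc rep_c[OF x] by (simp add: rep_pow int_pow_mult m_assoc)
  qed
  define R where "R = rep ` carrier G"
  have finR: "finite R"
  proof -
    have "R \<subseteq> (\<lambda>C. SOME y. y \<in> C) ` (rcosets H)"
      unfolding R_def rep_def RCOSETS_def by blast
    then show ?thesis using H(2) by (meson finite_imageI finite_subset)
  qed
  have "height_function G c k"
  proof unfold_locales
    fix x assume x: "x \<in> carrier G"
    show "k (c \<otimes> x) = k x + 1" using k_pow[OF x, of 1] cc by simp
  next
    have "{x \<in> carrier G. k x = 0} \<subseteq> R"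
    proof
      fix x assume x: "x \<in> {x \<in> carrier G. k x = 0}"
      then have "x = c [^] (0::int) \<otimes> rep x" using k[of x] by simp
      then have "x = rep x" using x rep_c[of x] by simp
      then show "x \<in> R" using x unfolding R_def by blast
    qed
    then show "finite {x \<in> carrier G. k x = 0}" using finR finite_subset by blast
  next
    fix g assume g: "g \<in> carrier G"
    let ?M = "Max ((\<lambda>r. \<bar>k (r \<otimes> g)\<bar>) ` R)"
    have "\<bar>k (x \<otimes> g) - k x\<bar> \<le> ?M" if x: "x \<in> carrier G" for x
    proof -
      have "x \<otimes> g = c [^] (k x) \<otimes> rep x \<otimes> g" using k[OF x] by simp
      also have "\<dots> = c [^] (k x) \<otimes> (rep x \<otimes> g)" using cc g rep_c[OF x] by (simp add: m_assoc)
      finally have "k (x \<otimes> g) = k x + k (rep x \<otimes> g)" using k_pow g rep_c[OF x] by simp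
      moreover have "\<bar>k (rep x \<otimes> g)\<bar> \<le> ?M" using finR x by (intro Max_ge) (auto simp: R_def)
      ultimately show ?thesis by simp
    qed
    then show "\<exists>M. \<forall>x\<in>carrier G. \<bar>k (x \<otimes> g) - k x\<bar> \<le> M" by blast
  qed (rule cc)
  then show thesis by (rule that)
qed

lemma finite_or_cofinite_if_finitely_generated:
  assumes X: "bicommensurated G X" and fg: "finitely_generated_group G"
    and "\<not> finite_by G integer_group"
  shows "finite X \<or> finite (carrier G - X)"
proof (rule ccontr)
  assume neg: "\<not> ?thesis"
  obtain S where S: "S \<subseteq> carrier G" "finite S" "generate G S = carrier G"
    using fg by (auto simp: finitely_generated_group_def)
  have "right_commensurated X"
    using X by (simp add: bicommensurated_iff_jumps right_commensurated_def)
  moreover have "almost_stabilizer X = carrier G"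
    using X unfolding almost_stabilizer_def almost_eq_def bicommensurated_def by blast
  ultimately have "finite_by G integer_group"
    using neg by (intro finite_by_integer_if_stabilized[OF S]) auto
  with assms show False by simp
qed

lemma card_biends_eq_1:
  assumes "infinite (carrier G)" "\<not> finite_by G integer_group"
    and "\<not> (countable (carrier G) \<and> locally_finite_group G)"
  shows "card (biends G) = 1"
proof (rule card_biends_1[OF assms(1)])
  fix Y assume Y: "bicommensurated G Y"
  show "finite Y \<or> finite (carrier G - Y)"
    using assms finite_or_cofinite_if_uncountable[OF Y] finite_or_cofinite_if_finitely_generated[OF Y]
      finite_or_cofinite_if_not_finitely_generated[OF Y] by blast
qed

text \<open>
  Let \<open>a\<close> and \<open>b\<close> be lifts of a translation and of a reflection. The powers of \<open>a\<close> are distinct. A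
  homomorphism to \<open>\<int>\<close> kills the commutators of \<open>a\<^sup>n\<close> and \<open>b\<close>, which are distinct because they map
  to the translations by \<open>2n\<close>; so its kernel is infinite.
\<close>
lemma finite_by_dihedral_consequences:
  assumes "finite_by G infinite_dihedral_group"
  shows "infinite (carrier G)" "\<not> locally_finite_group G" "\<not> finite_by G integer_group"
proof -
  let ?D = infinite_dihedral_group
  obtain h where h: "h \<in> hom G ?D" "h ` carrier G = carrier ?D"
    by (rule finite_byD[OF group_axioms group_infinite_dihedral_group assms])
  have mult: "h (x \<otimes> y) = h x \<otimes>\<^bsub>?D\<^esub> h y" if "x \<in> carrier G" "y \<in> carrier G" for x y
    using hom_mult[OF h(1) that] .
  have onto: "\<exists>x \<in> carrier G. h x = d" for d
  proof -
    have "d \<in> h ` carrier G" using h(2) by (simp add: infinite_dihedral_group_def)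
    then show ?thesis by blast
  qed
  obtain a where a: "a \<in> carrier G" "h a = (1, False)" using onto by blast
  obtain b where b: "b \<in> carrier G" "h b = (0, True)" using onto by blast
  have one: "h \<one> = (0, False)"
    using hom_one[OF h(1) group_axioms group_infinite_dihedral_group] by (simp add: infinite_dihedral_group_def)
  have pow: "h (a [^] n) = (int n, False)" for n :: nat
    by (induction n) (use a one mult in \<open>simp_all add: infinite_dihedral_group_def\<close>)
  have inj: "inj (\<lambda>n::nat. a [^] n)"
  proof (rule injI)
    fix m n :: nat assume "a [^] m = a [^] n"
    then have "h (a [^] m) = h (a [^] n)" by simp
    then show "m = n" by (simp add: pow)
  qed
  have "range (\<lambda>n::nat. a [^] n) \<subseteq> generate G {a}"
  proof clarify
    fix n :: nat
    show "a [^] n \<in> generate G {a}"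
    proof (induction n)
      case (Suc n)
      then have "a [^] n \<otimes> a \<in> generate G {a}"
        using generate.eng[OF _ generate.incl[of a "{a}"]] by blast
      then show ?case by simp
    qed (simp add: generate.one)
  qed
  then have infgen: "infinite (generate G {a})" using inj range_inj_infinite finite_subset by blast
  have gensub: "generate G {a} \<subseteq> carrier G" using generate_incl[of "{a}"] a by simp
  show "infinite (carrier G)" using infgen gensub finite_subset by blast
  show "\<not> locally_finite_group G"
    using infgen a unfolding locally_finite_group_def by blast
  show "\<not> finite_by G integer_group"
  proof
    assume "finite_by G integer_group"
    then obtain p where p: "p \<in> hom G integer_group" "finite {g \<in> carrier G. p g = 0}"
      using finite_byD[OF group_axioms group_integer_group] by (metis one_integer_group)
    have padd: "p (x \<otimes> y) = p x + p y" if "x \<in> carrier G" "y \<in> carrier G" for x y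
      using hom_mult[OF p(1) that] by simp
    define w where "w n = a [^] n \<otimes> b \<otimes> inv (b \<otimes> a [^] n)" for n :: nat
    have wc: "w n \<in> carrier G" for n using a b by (simp add: w_def)
    have w: "w n \<otimes> (b \<otimes> a [^] n) = a [^] n \<otimes> b" for n using a b by (simp add: w_def m_assoc del: inv_mult_group)
    have "p (w n) = 0" for n
    proof -
      have "p (w n) + (p b + p (a [^] n)) = p (a [^] n) + p b"
        using arg_cong[OF w[of n], of p] a b wc by (simp add: padd)
      then show ?thesis by simp
    qed
    moreover have hw: "fst (h (w n)) = 2 * int n" for n
    proof -
      have "h (w n) \<otimes>\<^bsub>?D\<^esub> (h b \<otimes>\<^bsub>?D\<^esub> h (a [^] n)) = h (a [^] n) \<otimes>\<^bsub>?D\<^esub> h b"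
        using arg_cong[OF w[of n], of h] a b wc by (simp add: mult)
      then show ?thesis
        by (cases "h (w n)") (auto simp: pow b infinite_dihedral_group_def split: if_splits)
    qed
    have "inj w"
    proof (rule injI)
      fix m n assume "w m = w n"
      then have "fst (h (w m)) = fst (h (w n))" by (rule arg_cong)
      then show "m = n" unfolding hw by simp
    qed
    ultimately have "range w \<subseteq> {g \<in> carrier G. p g = 0}" using wc by blast
    then have "finite (range w)" using p(2) finite_subset by blast
    then show False using range_inj_infinite[OF \<open>inj w\<close>] by simp
  qed
qed

lemma virtually_cyclic_if_finite:
  assumes "finite (carrier G)"
  shows "virtually_cyclic_group G"
proof -
  have "rcosets {\<one>} \<subseteq> Pow (carrier G)"
    using r_coset_subset_G[of "{\<one>}"] by (auto simp: RCOSETS_def)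
  then have "finite (rcosets {\<one>})" using assms by (meson finite_Pow_iff finite_subset)
  moreover have "cyclic_group (subgroup_generated G {\<one>})" by (rule cyclic_group_generated)
  moreover have "subgroup {\<one>} G" by (rule triv_subgroup)
  ultimately show ?thesis unfolding virtually_cyclic_group_def by blast
qed

text \<open>
  From left to right, the only point that is not pure logic is that an infinite virtually cyclic group
  is finite-by-\<open>\<int>\<close> or finite-by-\<open>D\<^sub>\<infinity>\<close>.
\<close>
lemma single_biend_condition_iff:
  "\<not> finite (carrier G) \<and> \<not> finite_by G integer_group \<and>
     \<not> (infinite (carrier G) \<and> countable (carrier G) \<and> locally_finite_group G) \<longleftrightarrow>
   (finitely_generated_group G \<and> \<not> virtually_cyclic_group G) \<or>
   finite_by G infinite_dihedral_group \<or>
   (countable (carrier G) \<and> \<not> finitely_generated_group G \<and> \<not> locally_finite_group G) \<or>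
   uncountable (carrier G)" (is "?L \<longleftrightarrow> ?R")
proof -
  have fin_fg: "finitely_generated_group G" if "finite (carrier G)"
  proof -
    have "generate G (carrier G) = carrier G"
      using generate_incl[OF subset_refl] by (auto intro: generate.incl)
    then show ?thesis using that unfolding finitely_generated_group_def by blast
  qed
  have fg_lf: "finite (carrier G)" if "finitely_generated_group G" "locally_finite_group G"
    using that unfolding finitely_generated_group_def locally_finite_group_def by metis
  have fg_countable: "countable (carrier G)" if "finitely_generated_group G"
    using that countable_generate countable_finite unfolding finitely_generated_group_def by metis
  have Z: "finitely_generated_group G \<and> virtually_cyclic_group G \<and> \<not> locally_finite_group G \<and> infinite (carrier G)"
    if fz: "finite_by G integer_group"
  proof -
    obtain c k where hf: "height_function G c k"
      by (rule height_function_if_finite_by_integer[OF fz])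
    show ?thesis
      using height_function.finitely_generated[OF hf] height_function.virtually_cyclic[OF hf]
        height_function.not_locally_finite[OF hf] height_function.infinite_carrier[OF hf] by blast
  qed
  have vc: "finite_by G integer_group \<or> finite_by G infinite_dihedral_group"
    if v: "virtually_cyclic_group G" "infinite (carrier G)"
  proof -
    obtain c k where hf: "height_function G c k" by (rule height_function_if_virtually_cyclic[OF v])
    show ?thesis by (rule height_function.finite_by_integer_or_dihedral[OF hf])
  qed
  show ?thesis
  proof
    assume ?L
    then show ?R using vc by blast
  next
    assume ?R
    then consider "finitely_generated_group G" "\<not> virtually_cyclic_group G"
      | "finite_by G infinite_dihedral_group"
      | "\<not> finitely_generated_group G" "\<not> locally_finite_group G"
      | "uncountable (carrier G)" by blast
    then show ?L
    proof cases
      case 1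
      then show ?thesis using virtually_cyclic_if_finite Z fg_lf by blast
    next
      case 2
      then show ?thesis using finite_by_dihedral_consequences by blast
    next
      case 3
      then show ?thesis using fin_fg Z by blast
    next
      case 4
      have "infinite (carrier G)" using 4 countable_finite by blast
      moreover have "\<not> finite_by G integer_group" using 4 Z fg_countable by blast
      ultimately show ?thesis using 4 by blast
    qed
  qed
qed

end

section \<open>Locally finite groups and the boundary of the natural numbers\<close>

text \<open>
  A prime ideal that omits some singleton \<open>{n}\<close> is the principal one at \<open>n\<close>, so the nonprincipal
  ones are those that contain all finite sets.
\<close>
lemma topspace_boundary_iff:
  "J \<in> topspace stone_cech_boundary_nat \<longleftrightarrow> UNIV \<notin> J \<and> (\<forall>X. finite X \<longrightarrow> X \<in> J) \<and>
    (\<forall>X Y. (X \<inter> Y \<in> J \<longleftrightarrow> X \<in> J \<or> Y \<in> J) \<and> (sym_diff X Y \<in> J \<longleftrightarrow> (X \<in> J \<longleftrightarrow> Y \<in> J)))"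
  (is "_ \<longleftrightarrow> ?U \<and> ?F \<and> ?B")
proof -
  have R: "cring (set_ring (UNIV :: nat set) UNIV)" by (rule cring_set_ring) auto
  have prime: "primeideal J (set_ring UNIV UNIV) \<longleftrightarrow> ?U \<and> ?B"
    unfolding primeideal_set_ring_iff[OF R] by (simp only: ball_UNIV subset_UNIV simp_thms)
  have "J \<in> topspace stone_cech_boundary_nat \<longleftrightarrow>
      primeideal J (set_ring UNIV UNIV) \<and> (\<forall>n. J \<noteq> {X. n \<notin> X})"
    unfolding stone_cech_boundary_nat_def beta_nat_def topspace_subtopology
      topspace_stone_dual[OF cring.axioms(1)[OF R]] by blast
  then have top: "J \<in> topspace stone_cech_boundary_nat \<longleftrightarrow>
      (?U \<and> ?B) \<and> (\<forall>n. J \<noteq> {X. n \<notin> X})"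
    by (simp only: prime)
  have "(\<forall>n. J \<noteq> {X. n \<notin> X}) \<longleftrightarrow> ?F" if UB: "?U" "?B"
  proof
    have int: "X \<inter> Y \<in> J \<longleftrightarrow> X \<in> J \<or> Y \<in> J" and sd: "sym_diff X Y \<in> J \<longleftrightarrow> (X \<in> J \<longleftrightarrow> Y \<in> J)" for X Y
      using UB(2) by blast+
    have empty: "{} \<in> J" using sd[of UNIV UNIV] by simp
    assume np: "\<forall>n. J \<noteq> {X. n \<notin> X}"
    have sing: "{n} \<in> J" for n
    proof (rule ccontr)
      assume n: "{n} \<notin> J"
      have "X \<in> J \<longleftrightarrow> n \<notin> X" for X
        using int[of "{n}" X] n empty by (cases "n \<in> X") simp_all
      then show False using np by blast
    qed
    show ?F
    proof (intro allI impI)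
      fix X :: "nat set" assume "finite X"
      then show "X \<in> J"
      proof induction
        case (insert x X)
        then have "sym_diff {x} X = insert x X" by blast
        then show ?case using sd[of "{x}" X] sing insert.IH by simp
      qed (rule empty)
    qed
  next
    assume F: ?F
    then have "{n} \<in> J" for n by blast
    then show "\<forall>n. J \<noteq> {X. n \<notin> X}" by blast
  qed
  with top show ?thesis by argo
qed

text \<open>
  By Zorn's lemma \<open>B\<close> extends to a maximal family with infinite finite intersections; such a family
  is an ultrafilter without finite members, and its complement is the point sought.
\<close>
lemma boundary_point_avoiding:
  fixes B :: "nat set set"
  assumes fip: "\<And>F. finite F \<Longrightarrow> F \<subseteq> B \<Longrightarrow> infinite (\<Inter>F)"
  obtains J where "J \<in> topspace stone_cech_boundary_nat" "J \<inter> B = {}"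
proof -
  let ?P = "\<lambda>M :: nat set set. \<forall>F. finite F \<longrightarrow> F \<subseteq> M \<longrightarrow> infinite (\<Inter>F)"
  define \<A> where "\<A> = {M. B \<subseteq> M \<and> ?P M}"
  have "B \<in> \<A>" using fip by (simp add: \<A>_def)
  have "\<exists>M\<in>\<A>. \<forall>X\<in>\<A>. M \<subseteq> X \<longrightarrow> X = M"
  proof (rule subset_Zorn_nonempty)
    show "\<A> \<noteq> {}" using \<open>B \<in> \<A>\<close> by blast
    fix \<C> assume C: "\<C> \<noteq> {}" "subset.chain \<A> \<C>"
    have "infinite (\<Inter>F)" if F: "finite F" "F \<subseteq> \<Union>\<C>" for F
    proof -
      obtain M where "M \<in> \<C>" "F \<subseteq> M" by (rule finite_subset_Union_chain[OF F C])
      then show ?thesis using C(2) F(1) unfolding \<A>_def subset.chain_def by blast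
    qed
    moreover have "B \<subseteq> \<Union>\<C>" using C unfolding \<A>_def subset.chain_def by blast
    ultimately show "\<Union>\<C> \<in> \<A>" by (simp add: \<A>_def)
  qed
  then obtain M where M: "M \<in> \<A>" and max: "\<And>X. X \<in> \<A> \<Longrightarrow> M \<subseteq> X \<Longrightarrow> X = M" by blast
  have BM: "B \<subseteq> M" and PM: "\<And>F. finite F \<Longrightarrow> F \<subseteq> M \<Longrightarrow> infinite (\<Inter>F)"
    using M by (auto simp: \<A>_def)
  have in_M: "X \<in> M" if X: "\<And>F. finite F \<Longrightarrow> F \<subseteq> M \<Longrightarrow> infinite (X \<inter> \<Inter>F)" for X
  proof -
    have "infinite (\<Inter>F)" if F: "finite F" "F \<subseteq> insert X M" for F
    proof -
      have "infinite (X \<inter> \<Inter>(F - {X}))" using F by (intro X) auto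
      moreover have "X \<inter> \<Inter>(F - {X}) \<subseteq> \<Inter>F" by blast
      ultimately show ?thesis using finite_subset by blast
    qed
    then have "insert X M \<in> \<A>" using BM by (auto simp: \<A>_def)
    then have "insert X M = M" by (rule max) blast
    then show ?thesis by blast
  qed
  have M_Int: "X \<inter> Y \<in> M" if "X \<in> M" "Y \<in> M" for X Y
  proof (rule in_M)
    fix F assume "finite F" "F \<subseteq> M"
    then have "infinite (\<Inter>(insert X (insert Y F)))" using that by (intro PM) auto
    then show "infinite (X \<inter> Y \<inter> \<Inter>F)" by (simp add: Int_assoc)
  qed
  have M_up: "Y \<in> M" if "X \<in> M" "X \<subseteq> Y" for X Y
  proof (rule in_M)
    fix F assume "finite F" "F \<subseteq> M"
    then have "infinite (\<Inter>(insert X F))" using that by (intro PM) auto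
    moreover have "\<Inter>(insert X F) \<subseteq> Y \<inter> \<Inter>F" using that by auto
    ultimately show "infinite (Y \<inter> \<Inter>F)" using finite_subset by blast
  qed
  have M_infinite: "infinite X" if "X \<in> M" for X using PM[of "{X}"] that by simp
  have M_or: "X \<in> M \<or> - X \<in> M" for X
  proof (rule ccontr)
    assume "\<not> ?thesis"
    then obtain F1 F2 where F1: "finite F1" "F1 \<subseteq> M" "finite (X \<inter> \<Inter>F1)"
      and F2: "finite F2" "F2 \<subseteq> M" "finite (- X \<inter> \<Inter>F2)"
      using in_M[of X] in_M[of "- X"] by blast
    have "\<Inter>(F1 \<union> F2) \<subseteq> (X \<inter> \<Inter>F1) \<union> (- X \<inter> \<Inter>F2)" by blast
    then have "finite (\<Inter>(F1 \<union> F2))" using F1 F2 finite_subset by blast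
    moreover have "infinite (\<Inter>(F1 \<union> F2))" using F1 F2 by (intro PM) auto
    ultimately show False by blast
  qed
  have disj: False if "X \<in> M" "Y \<in> M" "X \<inter> Y = {}" for X Y
    using M_infinite[OF M_Int[OF that(1,2)]] that(3) by simp
  have "- M \<in> topspace stone_cech_boundary_nat"
    unfolding topspace_boundary_iff
  proof (intro conjI allI impI)
    have "UNIV \<in> M" using PM by (intro in_M) simp
    then show "UNIV \<notin> - M" by blast
  next
    fix X Y
    show "X \<inter> Y \<in> - M \<longleftrightarrow> X \<in> - M \<or> Y \<in> - M"
      using M_Int[of X Y] M_up[of "X \<inter> Y" X] M_up[of "X \<inter> Y" Y] by auto
    have "sym_diff X Y \<in> M \<longleftrightarrow> (X \<in> M \<longleftrightarrow> Y \<notin> M)"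
    proof (cases "X \<in> M"; cases "Y \<in> M")
      assume "X \<in> M" "Y \<in> M"
      then have "X \<inter> Y \<in> M" by (rule M_Int)
      then show ?thesis using disj[of "sym_diff X Y" "X \<inter> Y"] \<open>X \<in> M\<close> \<open>Y \<in> M\<close> by blast
    next
      assume "X \<in> M" "Y \<notin> M"
      then have "X \<inter> - Y \<in> M" using M_or[of Y] by (intro M_Int) auto
      then have "sym_diff X Y \<in> M" by (rule M_up) blast
      then show ?thesis using \<open>X \<in> M\<close> \<open>Y \<notin> M\<close> by simp
    next
      assume "X \<notin> M" "Y \<in> M"
      then have "- X \<inter> Y \<in> M" using M_or[of X] by (intro M_Int) auto
      then have "sym_diff X Y \<in> M" by (rule M_up) blast
      then show ?thesis using \<open>X \<notin> M\<close> \<open>Y \<in> M\<close> by simp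
    next
      assume "X \<notin> M" "Y \<notin> M"
      then have "- X \<inter> - Y \<in> M" using M_or[of X] M_or[of Y] by (intro M_Int) auto
      then show ?thesis using disj[of "sym_diff X Y" "- X \<inter> - Y"] \<open>X \<notin> M\<close> \<open>Y \<notin> M\<close> by blast
    qed
    then show "sym_diff X Y \<in> - M \<longleftrightarrow> (X \<in> - M \<longleftrightarrow> Y \<in> - M)" unfolding Compl_iff by blast
  qed (use M_infinite in blast)
  moreover have "- M \<inter> B = {}" using BM by blast
  ultimately show thesis by (rule that)
qed

definition prefix_code :: "nat set \<Rightarrow> nat \<Rightarrow> bool list"
  where "prefix_code A n = map (\<lambda>i. i \<in> A) [0..<n]"

text \<open>
  An element of the independent set of \<open>A\<close> is the code of a length \<open>n\<close> and a finite list of words that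
  contains the initial segment of length \<open>n\<close> of the characteristic function of \<open>A\<close>. As \<open>A\<close> varies this
  is the classical independent family of continuum many subsets of a countable set.
\<close>
definition independent_set :: "nat set \<Rightarrow> nat set"
  where "independent_set A = {m. case from_nat m of (n, L) \<Rightarrow> prefix_code A n \<in> set (L :: bool list list)}"

text \<open>
  If \<open>n\<close> is large, the initial segments of length \<open>n\<close> of the members of \<open>P\<close> differ from those of the
  members of \<open>N\<close>. The code of \<open>n\<close> and the list of the former is then in the intersection.
\<close>
lemma independent_sets:
  assumes "finite P" "finite N" "P \<inter> N = {}"
  shows "infinite ((\<Inter>A\<in>P. independent_set A) \<inter> (\<Inter>A\<in>N. - independent_set A))"
proof -
  have "\<exists>i. i \<in> a \<longleftrightarrow> i \<notin> b" if "a \<in> P" "b \<in> N" for a b :: "nat set"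
  proof -
    have "a \<noteq> b" using that assms(3) by blast
    then show ?thesis by blast
  qed
  then obtain d where d: "\<And>a b. a \<in> P \<Longrightarrow> b \<in> N \<Longrightarrow> d a b \<in> a \<longleftrightarrow> d a b \<notin> b" by metis
  define n0 where "n0 = Suc (Max (insert 0 ((\<lambda>(a, b). d a b) ` (P \<times> N))))"
  have n0: "d a b < n0" if "a \<in> P" "b \<in> N" for a b
  proof -
    have "d a b \<in> insert 0 ((\<lambda>(a, b). d a b) ` (P \<times> N))" using that by force
    then have "d a b \<le> Max (insert 0 ((\<lambda>(a, b). d a b) ` (P \<times> N)))"
      using assms by (intro Max_ge) auto
    then show ?thesis by (simp add: n0_def)
  qed
  obtain Ps where Ps: "set Ps = P" using finite_list[OF assms(1)] by blast
  define code where "code n = to_nat (n, map (\<lambda>A. prefix_code A n) Ps)" for n :: nat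
  have code: "code n \<in> independent_set A \<longleftrightarrow> prefix_code A n \<in> (\<lambda>A. prefix_code A n) ` P" for n A
    by (simp add: independent_set_def code_def Ps)
  have "inj code" by (auto simp: inj_def code_def)
  then have "infinite (code ` {n0..})" by (simp add: finite_image_iff inj_on_subset infinite_Ici)
  moreover have "code ` {n0..} \<subseteq> (\<Inter>A\<in>P. independent_set A) \<inter> (\<Inter>A\<in>N. - independent_set A)"
  proof (rule image_subsetI)
    fix n assume n: "n \<in> {n0..}"
    have "code n \<notin> independent_set b" if b: "b \<in> N" for b
    proof
      assume "code n \<in> independent_set b"
      then obtain a where a: "a \<in> P" "prefix_code b n = prefix_code a n" unfolding code by blast
      have "d a b < n" using n0[OF a(1) b] n by simp
      then have "d a b \<in> b \<longleftrightarrow> d a b \<in> a" using a(2) by (simp add: prefix_code_def)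
      then show False using d[OF a(1) b] by blast
    qed
    moreover have "code n \<in> independent_set a" if "a \<in> P" for a
      unfolding code using that by blast
    ultimately show "code n \<in> (\<Inter>A\<in>P. independent_set A) \<inter> (\<Inter>A\<in>N. - independent_set A)" by blast
  qed
  ultimately show ?thesis using finite_subset by blast
qed

text \<open>
  Each family \<open>\<A>\<close> of subsets of \<open>\<nat>\<close> is recovered from a point of the boundary that avoids the
  independent sets of the members of \<open>\<A>\<close> and the complements of those of the non-members.
\<close>
lemma lepoll_boundary: "(UNIV :: nat set set set) \<lesssim> topspace stone_cech_boundary_nat"
proof -
  have "\<exists>J. J \<in> topspace stone_cech_boundary_nat \<and> {A. independent_set A \<notin> J} = \<A>" for \<A>
  proof -
    let ?B = "independent_set ` \<A> \<union> (\<lambda>A. - independent_set A) ` (- \<A>)"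
    obtain J where J: "J \<in> topspace stone_cech_boundary_nat" "J \<inter> ?B = {}"
    proof (rule boundary_point_avoiding[of ?B])
      fix F assume F: "finite F" "F \<subseteq> ?B"
      have "finite (F \<inter> independent_set ` \<A>)" using F by blast
      from finite_subset_image[OF this Int_lower2]
      obtain P where P: "P \<subseteq> \<A>" "finite P" "F \<inter> independent_set ` \<A> = independent_set ` P"
        by blast
      have "finite (F \<inter> (\<lambda>A. - independent_set A) ` (- \<A>))" using F by blast
      from finite_subset_image[OF this Int_lower2]
      obtain N where N: "N \<subseteq> - \<A>" "finite N"
        "F \<inter> (\<lambda>A. - independent_set A) ` (- \<A>) = (\<lambda>A. - independent_set A) ` N"
        by blast
      have "F = (F \<inter> independent_set ` \<A>) \<union> (F \<inter> (\<lambda>A. - independent_set A) ` (- \<A>))"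
        using F(2) by blast
      then have "F = independent_set ` P \<union> (\<lambda>A. - independent_set A) ` N"
        unfolding P(3) N(3) .
      then have "\<Inter>F = (\<Inter>A\<in>P. independent_set A) \<inter> (\<Inter>A\<in>N. - independent_set A)"
        by (simp only: Inf_union_distrib)
      moreover have "P \<inter> N = {}" using P N by blast
      ultimately show "infinite (\<Inter>F)" using independent_sets P N by simp
    qed
    have "independent_set A \<notin> J \<longleftrightarrow> A \<in> \<A>" for A
    proof
      assume "A \<in> \<A>"
      then show "independent_set A \<notin> J" using J(2) by blast
    next
      assume nJ: "independent_set A \<notin> J"
      show "A \<in> \<A>"
      proof (rule ccontr)
        assume "A \<notin> \<A>"
        then have "- independent_set A \<notin> J" using J(2) by blast
        then have "independent_set A \<inter> - independent_set A \<notin> J"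
          using nJ J(1) unfolding topspace_boundary_iff by blast
        moreover have "{} \<in> J" using J(1) unfolding topspace_boundary_iff by blast
        ultimately show False by simp
      qed
    qed
    then show ?thesis using J(1) by blast
  qed
  then obtain j where j: "\<And>\<A>. j \<A> \<in> topspace stone_cech_boundary_nat"
    "\<And>\<A>. {A. independent_set A \<notin> j \<A>} = \<A>" by metis
  have "inj j" by (rule inj_on_inverseI[where g = "\<lambda>J. {A. independent_set A \<notin> J}"]) (rule j(2))
  then show ?thesis unfolding lepoll_def using j(1) by blast
qed

context group
begin

text \<open>
  With \<open>H\<^sub>n\<close> generated by the first \<open>n\<close> elements in an enumeration of \<open>G\<close>, let \<open>l(x)\<close> be the least
  \<open>n\<close> with \<open>x \<in> H\<^sub>n\<close>. If \<open>x\<close> lies outside the finite group \<open>H\<close> with index \<open>l(g)\<close>, then \<open>gx\<close> and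
  \<open>xg\<close> lie in the same \<open>H\<^sub>n\<close> as \<open>x\<close>. The values of \<open>l\<close> are renumbered so that every natural number
  is attained.
\<close>
lemma level_function:
  assumes inf: "infinite (carrier G)" and cnt: "countable (carrier G)" and lf: "locally_finite_group G"
  obtains lev :: "'a \<Rightarrow> nat" where "lev ` carrier G = UNIV"
    "\<forall>n. finite {x \<in> carrier G. lev x = n}"
    "\<forall>g \<in> carrier G. finite {x \<in> carrier G. lev (g \<otimes> x) \<noteq> lev x \<or> lev (x \<otimes> g) \<noteq> lev x}"
proof -
  let ?e = "from_nat_into (carrier G)"
  have "carrier G \<noteq> {}" using one_closed by blast
  then have e: "range ?e = carrier G" using cnt by (rule range_from_nat_into)
  define H where "H n = generate G (?e ` {..<n})" for n
  have ec: "?e ` A \<subseteq> carrier G" for A using e by blast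
  have finH: "finite (H n)" for n
    using lf ec[of "{..<n}"] by (simp add: locally_finite_group_def H_def)
  have subH: "subgroup (H n) G" for n unfolding H_def by (rule generate_is_subgroup[OF ec])
  have monoH: "H m \<subseteq> H n" if "m \<le> n" for m n
    unfolding H_def by (rule mono_generate) (use that in auto)
  have cover: "\<exists>n. x \<in> H n" if x: "x \<in> carrier G" for x
  proof -
    have "x \<in> range ?e" using x e by simp
    then obtain i where "x = ?e i" by (rule imageE)
    then have "x \<in> H (Suc i)" unfolding H_def by (intro generate.incl) auto
    then show ?thesis by blast
  qed
  define l where "l x = (LEAST n. x \<in> H n)" for x
  have l: "x \<in> H n \<longleftrightarrow> l x \<le> n" if "x \<in> carrier G" for x n
  proof
    assume "l x \<le> n"
    moreover have "x \<in> H (l x)" unfolding l_def using cover[OF that] by (rule LeastI_ex)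
    ultimately show "x \<in> H n" using monoH by blast
  qed (auto simp: l_def intro: Least_le)
  let ?L = "l ` carrier G"
  have infL: "infinite ?L"
  proof
    assume fin: "finite ?L"
    have "carrier G \<subseteq> H (Max ?L)" using l fin by auto
    then show False using inf finH finite_subset by blast
  qed
  have bij: "bij_betw (enumerate ?L) UNIV ?L" by (rule bij_enumerate[OF infL])
  define lev where "lev x = inv_into UNIV (enumerate ?L) (l x)" for x
  have lev: "lev x = n \<longleftrightarrow> l x = enumerate ?L n" if "x \<in> carrier G" for x n
    using bij that unfolding lev_def bij_betw_def by (metis f_inv_into_f image_eqI inv_f_f)
  show thesis
  proof (rule that[of lev])
    have "n \<in> lev ` carrier G" for n
    proof -
      have "enumerate ?L n \<in> ?L" using enumerate_in_set[OF infL] .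
      then obtain x where x: "x \<in> carrier G" "l x = enumerate ?L n" by auto
      then have "lev x = n" by (simp add: lev)
      then show ?thesis using x(1) by blast
    qed
    then show "lev ` carrier G = UNIV" by blast
    show "\<forall>n. finite {x \<in> carrier G. lev x = n}"
    proof
      fix n
      have "x \<in> H (enumerate ?L n)" if x: "x \<in> carrier G" "lev x = n" for x
      proof -
        have "l x = enumerate ?L n" using lev[OF x(1), of n] x(2) by blast
        then show ?thesis using l[OF x(1)] by simp
      qed
      then have "{x \<in> carrier G. lev x = n} \<subseteq> H (enumerate ?L n)" by blast
      then show "finite {x \<in> carrier G. lev x = n}" using finH finite_subset by blast
    qed
    show "\<forall>g\<in>carrier G. finite {x \<in> carrier G. lev (g \<otimes> x) \<noteq> lev x \<or> lev (x \<otimes> g) \<noteq> lev x}"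
    proof
      fix g assume g: "g \<in> carrier G"
      interpret Hg: subgroup "H (l g)" G by (rule subH)
      have gH: "g \<in> H (l g)" using l[OF g] by simp
      have "lev (g \<otimes> x) = lev x \<and> lev (x \<otimes> g) = lev x" if x: "x \<in> carrier G" "x \<notin> H (l g)" for x
      proof -
        have same: "l y = l x" if y: "y \<in> carrier G" "\<And>n. g \<in> H n \<Longrightarrow> y \<in> H n \<longleftrightarrow> x \<in> H n" for y
        proof -
          have "y \<in> H n \<longleftrightarrow> x \<in> H n" for n
          proof (cases "l g \<le> n")
            case True
            then show ?thesis using y(2) l[OF g] by blast
          next
            case False
            then have "H n \<subseteq> H (l g)" by (intro monoH) simp
            then show ?thesis using x(2) y(2)[OF gH] by blast
          qed
          then show ?thesis by (simp add: l_def)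
        qed
        have mult: "g \<otimes> x \<in> H n \<longleftrightarrow> x \<in> H n" "x \<otimes> g \<in> H n \<longleftrightarrow> x \<in> H n" if gn: "g \<in> H n" for n
        proof -
          interpret Hn: subgroup "H n" G by (rule subH)
          have ig: "inv g \<in> H n" by (rule Hn.m_inv_closed[OF gn])
          have "inv g \<otimes> (g \<otimes> x) = x" "x \<otimes> g \<otimes> inv g = x"
            using g x(1) by (simp_all add: m_assoc flip: m_assoc[of "inv g" g])
          then show "g \<otimes> x \<in> H n \<longleftrightarrow> x \<in> H n" "x \<otimes> g \<in> H n \<longleftrightarrow> x \<in> H n"
            using Hn.m_closed[OF gn] Hn.m_closed[OF _ gn] Hn.m_closed[OF ig] Hn.m_closed[OF _ ig] by metis+
        qed
        have "l (g \<otimes> x) = l x" by (rule same[OF m_closed[OF g x(1)] mult(1)])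
        moreover have "l (x \<otimes> g) = l x" by (rule same[OF m_closed[OF x(1) g] mult(2)])
        ultimately show ?thesis by (simp add: lev_def)
      qed
      then have "{x \<in> carrier G. lev (g \<otimes> x) \<noteq> lev x \<or> lev (x \<otimes> g) \<noteq> lev x} \<subseteq> H (l g)" by blast
      then show "finite {x \<in> carrier G. lev (g \<otimes> x) \<noteq> lev x \<or> lev (x \<otimes> g) \<noteq> lev x}"
        using finH finite_subset by blast
    qed
  qed
qed

text \<open>
  The map sends a bi-end to its trace on the algebra of the sets \<open>X A\<close>, which is isomorphic to the
  algebra of all subsets of \<open>\<nat>\<close>. It is onto because a section \<open>s\<close> of the level function pulls an
  ultrafilter on \<open>\<nat>\<close> back to the bi-commensurated sets.
\<close>
lemma biends_map_onto_boundary: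
  assumes "infinite (carrier G)" "countable (carrier G)" "locally_finite_group G"
  obtains f where "continuous_map (biend_space G) stone_cech_boundary_nat f"
    "f ` biends G = topspace stone_cech_boundary_nat"
proof -
  obtain lev :: "'a \<Rightarrow> nat" where onto: "lev ` carrier G = UNIV"
    and fib: "\<forall>n. finite {x \<in> carrier G. lev x = n}"
    and jump: "\<forall>g \<in> carrier G. finite {x \<in> carrier G. lev (g \<otimes> x) \<noteq> lev x \<or> lev (x \<otimes> g) \<noteq> lev x}"
    by (rule level_function[OF assms])
  define X where "X A = {x \<in> carrier G. lev x \<in> A}" for A
  have X: "bicommensurated G (X A)" for A
    unfolding bicommensurated_iff_jumps
  proof (intro conjI ballI)
    fix g assume g: "g \<in> carrier G"
    let ?J = "{x \<in> carrier G. lev (g \<otimes> x) \<noteq> lev x \<or> lev (x \<otimes> g) \<noteq> lev x}"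
    have fin: "finite ?J" using jump g by blast
    have "left_jumps (X A) g \<subseteq> ?J" "right_jumps (X A) g \<subseteq> ?J"
      using g by (auto simp: X_def left_jumps_def right_jumps_def)
    then show "finite (left_jumps (X A) g)" "finite (right_jumps (X A) g)"
      using fin finite_subset by blast+
  qed (auto simp: X_def)
  have X_Int: "X (A \<inter> B) = X A \<inter> X B" and X_sd: "X (sym_diff A B) = sym_diff (X A) (X B)" for A B
    by (auto simp: X_def)
  have X_fin: "finite (X A)" if "finite A" for A
  proof -
    have "X A = (\<Union>n\<in>A. {x \<in> carrier G. lev x = n})" by (auto simp: X_def)
    then show ?thesis using that fib by simp
  qed
  have X_UNIV: "X UNIV = carrier G" by (auto simp: X_def)
  define \<Phi> where "\<Phi> P = {X. bicommensurated G X \<and> mod_finite_class G X \<in> P}" for P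
  have \<Phi>: "bij_betw \<Phi> (biends G) (biend_ideals G)" unfolding \<Phi>_def by (rule bij_betw_biends)
  define f where "f P = {A. mod_finite_class G (X A) \<in> P}" for P
  have f_\<Phi>: "f P = {A. X A \<in> \<Phi> P}" for P using X by (simp add: f_def \<Phi>_def)
  have f_top: "f P \<in> topspace stone_cech_boundary_nat" if P: "P \<in> biends G" for P
  proof -
    have "\<Phi> P \<in> biend_ideals G" using \<Phi> P by (rule bij_betwE[THEN bspec])
    then have J: "carrier G \<notin> \<Phi> P" "\<And>X. X \<subseteq> carrier G \<Longrightarrow> finite X \<Longrightarrow> X \<in> \<Phi> P"
      "\<And>X Y. bicommensurated G X \<Longrightarrow> bicommensurated G Y \<Longrightarrow>
        (X \<inter> Y \<in> \<Phi> P \<longleftrightarrow> X \<in> \<Phi> P \<or> Y \<in> \<Phi> P) \<and> (sym_diff X Y \<in> \<Phi> P \<longleftrightarrow> (X \<in> \<Phi> P \<longleftrightarrow> Y \<in> \<Phi> P))"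
      unfolding biend_ideals_iff by blast+
    have "X A \<in> \<Phi> P" if "finite A" for A using J(2)[OF _ X_fin[OF that]] by (simp add: X_def)
    then show ?thesis
      using J(1) J(3)[OF X X] unfolding topspace_boundary_iff f_\<Phi> mem_Collect_eq X_UNIV X_Int X_sd by blast
  qed
  have f_onto: "\<exists>P \<in> biends G. f P = J" if J: "J \<in> topspace stone_cech_boundary_nat" for J
  proof -
    have "\<exists>x. x \<in> carrier G \<and> lev x = n" for n using onto by (metis UNIV_I imageE)
    then obtain s where s: "\<And>n. s n \<in> carrier G" "\<And>n. lev (s n) = n" by metis
    have "inj s" by (rule inj_on_inverseI[where g = lev]) (rule s(2))
    define K where "K = {Y. bicommensurated G Y \<and> s -` Y \<in> J}"
    have J': "UNIV \<notin> J" "\<And>X. finite X \<Longrightarrow> X \<in> J" "\<And>X Y. X \<inter> Y \<in> J \<longleftrightarrow> X \<in> J \<or> Y \<in> J"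
      "\<And>X Y. sym_diff X Y \<in> J \<longleftrightarrow> (X \<in> J \<longleftrightarrow> Y \<in> J)"
      using J unfolding topspace_boundary_iff by blast+
    have "K \<in> biend_ideals G"
      unfolding biend_ideals_iff
    proof (intro conjI allI impI)
      have "s -` carrier G = UNIV" using s(1) by blast
      then show "carrier G \<notin> K" using J'(1) by (simp add: K_def)
      show "Y \<in> K" if "Y \<subseteq> carrier G" "finite Y" for Y
        using bicommensurated_finite[OF that] J'(2) finite_vimageI[OF that(2) \<open>inj s\<close>] by (simp add: K_def)
      fix Y Z assume YZ: "bicommensurated G Y" "bicommensurated G Z"
      have vi: "s -` (Y \<inter> Z) = s -` Y \<inter> s -` Z" "s -` sym_diff Y Z = sym_diff (s -` Y) (s -` Z)" by auto
      show "Y \<inter> Z \<in> K \<longleftrightarrow> Y \<in> K \<or> Z \<in> K"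
        using bicommensurated_Int[OF group_axioms YZ] YZ J'(3) vi(1) by (simp add: K_def)
      show "sym_diff Y Z \<in> K \<longleftrightarrow> (Y \<in> K \<longleftrightarrow> Z \<in> K)"
        using bicommensurated_sym_diff[OF group_axioms YZ] YZ J'(4) unfolding K_def mem_Collect_eq vi(2) by blast
    qed (simp add: K_def)
    then have "K \<in> \<Phi> ` biends G" using \<Phi> by (simp add: bij_betw_def)
    then obtain P where P: "P \<in> biends G" "K = \<Phi> P" by (rule imageE)
    have "s -` X A = A" for A using s by (auto simp: X_def)
    then have "f P = J" unfolding f_\<Phi> P(2)[symmetric] K_def using X by simp
    then show ?thesis using P(1) by blast
  qed
  have image: "f ` biends G = topspace stone_cech_boundary_nat"
    using f_top f_onto by blast
  have "continuous_map (biend_space G) beta_nat f"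
    unfolding beta_nat_def stone_dual_def continuous_on_generated_topo_iff
  proof (intro conjI allI impI)
    fix U :: "nat set set set"
    assume "U \<in> (\<lambda>a. {P. primeideal P (set_ring UNIV UNIV) \<and> a \<notin> P}) ` carrier (set_ring UNIV UNIV)"
    then obtain A where U: "U = {P. primeideal P (set_ring UNIV UNIV) \<and> A \<notin> P}" by blast
    have prime: "primeideal (f P) (set_ring UNIV UNIV)" if "P \<in> biends G" for P
    proof -
      have R: "cring (set_ring (UNIV :: nat set) UNIV)" by (rule cring_set_ring) auto
      show ?thesis
        using f_top[OF that] unfolding stone_cech_boundary_nat_def beta_nat_def
          topspace_subtopology topspace_stone_dual[OF cring.axioms(1)[OF R]] by blast
    qed
    have "f -` U \<inter> biends G = {P. primeideal P (bicomm_algebra_mod_finite G) \<and> mod_finite_class G (X A) \<notin> P}"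
      using prime unfolding U f_def biends_eq by blast
    moreover have "openin (biend_space G) \<dots>"
      unfolding biend_space_def stone_dual_def
      by (intro topology_generated_by_Basis imageI) (use X carrier_bicomm_algebra_mod_finite in blast)
    ultimately show "openin (biend_space G) (f -` U \<inter> biends G)" by simp
  next
    have "f ` biends G \<subseteq> topspace beta_nat"
      using image by (simp add: stone_cech_boundary_nat_def)
    then show "f ` biends G \<subseteq> \<Union> ((\<lambda>a. {P. primeideal P (set_ring UNIV UNIV) \<and> a \<notin> P}) ` carrier (set_ring UNIV UNIV))"
      unfolding beta_nat_def stone_dual_def topology_generated_by_topspace .
  qed
  then have "continuous_map (biend_space G) stone_cech_boundary_nat f"
    using image unfolding stone_cech_boundary_nat_def continuous_map_in_subtopology by auto
  then show thesis using image by (rule that)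
qed

lemma eqpoll_biends_locally_finite:
  assumes "infinite (carrier G)" "countable (carrier G)" "locally_finite_group G"
  shows "biends G \<approx> (UNIV :: nat set set set)"
proof (rule lepoll_antisym)
  have "biends G \<approx> biend_ideals G" unfolding eqpoll_def by (intro exI) (rule bij_betw_biends)
  also have "biend_ideals G \<lesssim> Pow (Pow (carrier G))"
  proof (rule subset_imp_lepoll, rule subsetI)
    fix J assume "J \<in> biend_ideals G"
    then have "\<forall>X\<in>J. bicommensurated G X" unfolding biend_ideals_iff by blast
    moreover have "X \<subseteq> carrier G" if "bicommensurated G X" for X
      using that by (simp add: bicommensurated_def)
    ultimately show "J \<in> Pow (Pow (carrier G))" by blast
  qed
  also have "Pow (Pow (carrier G)) \<lesssim> (UNIV :: nat set set set)"
  proof -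
    have inj: "inj_on (to_nat_on (carrier G)) (carrier G)" by (rule inj_on_to_nat_on[OF assms(2)])
    have "inj_on ((`) ((`) (to_nat_on (carrier G)))) (Pow (Pow (carrier G)))"
      by (rule inj_on_image_Pow[OF inj_on_image_Pow[OF inj]])
    then show ?thesis
      unfolding lepoll_def by (intro exI[of _ "(`) ((`) (to_nat_on (carrier G)))"] conjI) simp_all
  qed
  finally show "biends G \<lesssim> (UNIV :: nat set set set)" .
  obtain f where "f ` biends G = topspace stone_cech_boundary_nat"
    by (rule biends_map_onto_boundary[OF assms])
  then have "topspace stone_cech_boundary_nat \<lesssim> biends G"
    using image_lepoll[of f "biends G"] by simp
  then show "(UNIV :: nat set set set) \<lesssim> biends G" by (rule lepoll_trans[OF lepoll_boundary])
qed

end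

section \<open>The number of bi-ends\<close>

theorem theorem1p24:
  fixes G :: "('a, 'b) monoid_scheme"
  assumes "group G"
  shows "(finite (carrier G) \<longrightarrow> biends G = {}) \<and>
    (finite_by G integer_group \<longrightarrow> card (biends G) = 2) \<and>
    (infinite (carrier G) \<and> countable (carrier G) \<and> locally_finite_group G \<longrightarrow>
       biends G \<approx> (UNIV :: nat set set set) \<and>
       (\<exists>f. continuous_map (biend_space G) stone_cech_boundary_nat f \<and>
            f ` biends G = topspace stone_cech_boundary_nat)) \<and>
    (\<not> finite (carrier G) \<and> \<not> finite_by G integer_group \<and>
     \<not> (infinite (carrier G) \<and> countable (carrier G) \<and> locally_finite_group G) \<longrightarrow>
       card (biends G) = 1) \<and>
    (\<not> finite (carrier G) \<and> \<not> finite_by G integer_group \<and>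
     \<not> (infinite (carrier G) \<and> countable (carrier G) \<and> locally_finite_group G) \<longleftrightarrow>
       (finitely_generated_group G \<and> \<not> virtually_cyclic_group G) \<or>
       finite_by G infinite_dihedral_group \<or>
       (countable (carrier G) \<and> \<not> finitely_generated_group G \<and> \<not> locally_finite_group G) \<or>
       uncountable (carrier G))"
proof -
  interpret group G by fact
  have lf: "biends G \<approx> (UNIV :: nat set set set) \<and>
      (\<exists>f. continuous_map (biend_space G) stone_cech_boundary_nat f \<and>
           f ` biends G = topspace stone_cech_boundary_nat)"
    if *: "infinite (carrier G)" "countable (carrier G)" "locally_finite_group G"
  proof -
    obtain f where "continuous_map (biend_space G) stone_cech_boundary_nat f"
      "f ` biends G = topspace stone_cech_boundary_nat"
      by (rule biends_map_onto_boundary[OF *])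
    then show ?thesis using eqpoll_biends_locally_finite[OF *] by blast
  qed
  show ?thesis
  proof (intro conjI)
    show "finite (carrier G) \<longrightarrow> biends G = {}"
      by (intro impI) (rule biends_finite_group)
    show "finite_by G integer_group \<longrightarrow> card (biends G) = 2"
      by (intro impI) (rule card_biends_finite_by_integer)
    show "infinite (carrier G) \<and> countable (carrier G) \<and> locally_finite_group G \<longrightarrow>
       biends G \<approx> (UNIV :: nat set set set) \<and>
       (\<exists>f. continuous_map (biend_space G) stone_cech_boundary_nat f \<and>
            f ` biends G = topspace stone_cech_boundary_nat)"
      by (intro impI, elim conjE, rule lf)
    show "\<not> finite (carrier G) \<and> \<not> finite_by G integer_group \<and>
     \<not> (infinite (carrier G) \<and> countable (carrier G) \<and> locally_finite_group G) \<longrightarrow>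
       card (biends G) = 1"
      by (intro impI, elim conjE, rule card_biends_eq_1) blast+
  qed (rule single_biend_condition_iff)
qed

end
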